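(* For $i=1,2$ let $\mathcal{H}_i\subseteq\mathcal{K}_i$ be complex Hilbert spaces, let $T_i\in\mathcal{B}(\mathcal{H}_i)$ be a contraction and let $V_i\in\mathcal{B}(\mathcal{K}_i)$ be an isometric lifting of $T_i$. Let $X\in\mathcal{B}(\mathcal{H}_1,\mathcal{H}_2)$. Suppose $Q\in\mathcal{B}(\mathcal{H}_2)$ and $\overline{Q}\in\mathcal{B}(\mathcal{K}_2)$ are contractions with $\mathcal{H}_2$ reducing $\overline{Q}$ and $\overline{Q}|_{\mathcal{H}_2}=Q$. (i) If $XT_1=QT_2X$, then there exists a lifting $Y\in\mathcal{B}(\mathcal{K}_1,\mathcal{K}_2)$ of $X$ such that $YV_1=\overline{Q}V_2Y$. (ii) If $XT_1=T_2QX$, then there exists a lifting $Y\in\mathcal{B}(\mathcal{K}_1,\mathcal{K}_2)$ of $X$ such that $YV_1=V_2\overline{Q}Y$. Suppose instead $Q\in\mathcal{B}(\mathcal{H}_1)$ and $\overline{Q}\in\mathcal{B}(\mathcal{K}_1)$ are unitaries with $\mathcal{H}_1$ reducing $\overline{Q}$ and $\overline{Q}|_{\mathcal{H}_1}=Q$. (iii) If $XT_1=T_2XQ$, then there exists a lifting $Y\in\mathcal{B}(\mathcal{K}_1,\mathcal{K}_2)$ of $X$ such that $YV_1=V_2Y\overline{Q}$. In all cases $T_2^nX=P_{\mathcal{H}_2}V_2^nY|_{\mathcal{H}_1}$ and $XT_1^n=P_{\mathcal{H}_2}YV_1^n|_{\mathcal{H}_1}$ for all integers $n\geq 0$, and $Y$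 can be chosen such that $\|Y\|=\|X\|$.
   Context: For Hilbert spaces $\mathcal{H}_1\subseteq\mathcal{K}_1$, $\mathcal{H}_2\subseteq\mathcal{K}_2$, an operator $S\in\mathcal{B}(\mathcal{K}_1,\mathcal{K}_2)$ is a lifting of $T\in\mathcal{B}(\mathcal{H}_1,\mathcal{H}_2)$ if $S(\mathcal{H}_1^\perp)\subseteq\mathcal{H}_2^\perp$ and $T=P_{\mathcal{H}_2}S|_{\mathcal{H}_1}$ (equivalently $S^*|_{\mathcal{H}_2}=T^*$). An isometric lifting of a contraction is a lifting that is an isometry. $P_{\mathcal{H}_2}$ is the orthogonal projection onto $\mathcal{H}_2$. *)

theory Defs
  imports "HOL-Analysis.Analysis"
begin

class complex_inner = real_normed_vector +
  fixes scaleC :: "complex \<Rightarrow> 'a \<Rightarrow> 'a"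
    and cinner :: "'a \<Rightarrow> 'a \<Rightarrow> complex"
  assumes scaleC_of_real: "scaleC (complex_of_real r) x = scaleR r x"
    and scaleC_add_right: "scaleC a (x + y) = scaleC a x + scaleC a y"
    and scaleC_add_left: "scaleC (a + b) x = scaleC a x + scaleC b x"
    and scaleC_scaleC: "scaleC a (scaleC b x) = scaleC (a * b) x"
    and scaleC_one: "scaleC 1 x = x"
    and cinner_add_left: "cinner (x + y) z = cinner x z + cinner y z"
    and cinner_scaleC_left: "cinner (scaleC a x) y = cnj a * cinner x y"
    and cinner_commute: "cinner x y = cnj (cinner y x)"
    and cinner_self_norm: "cinner x x = complex_of_real ((norm x)\<^sup>2)"

class chilbert = complex_inner + complete_space

definition csubspace :: "'a::complex_inner set \<Rightarrow> bool" where
  "csubspace S \<longleftrightarrow> 0 \<in> S \<and> (\<forall>x\<in>S. \<forall>y\<in>S. x + y \<in> S) \<and> (\<forall>a. \<forall>x\<in>S. scaleC a x \<in> S)"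

definition closed_csubspace :: "'a::complex_inner set \<Rightarrow> bool" where
  "closed_csubspace S \<longleftrightarrow> csubspace S \<and> closed S"

definition orth_compl :: "'a::complex_inner set \<Rightarrow> 'a set" where
  "orth_compl S = {y. \<forall>x\<in>S. cinner x y = 0}"

definition orth_proj :: "'a::complex_inner set \<Rightarrow> 'a \<Rightarrow> 'a" where
  "orth_proj H x = (THE p. p \<in> H \<and> x - p \<in> orth_compl H)"

text \<open>T is a bounded (complex-linear) operator from the subspace H to the subspace H'.
  An operator in B(H,H') is represented by a function on the ambient space whose values
  outside H are irrelevant; equalities of such operators are stated pointwise on H.\<close>
definition bounded_op :: "'a::complex_inner set \<Rightarrow> 'b::complex_inner set \<Rightarrow> ('a \<Rightarrow> 'b) \<Rightarrow> bool" where
  "bounded_op H H' T \<longleftrightarrow>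
     (\<forall>x\<in>H. T x \<in> H') \<and>
     (\<forall>x\<in>H. \<forall>y\<in>H. T (x + y) = T x + T y) \<and>
     (\<forall>a. \<forall>x\<in>H. T (scaleC a x) = scaleC a (T x)) \<and>
     (\<exists>C. \<forall>x\<in>H. norm (T x) \<le> C * norm x)"

definition op_norm :: "'a::complex_inner set \<Rightarrow> ('a \<Rightarrow> 'b::complex_inner) \<Rightarrow> real" where
  "op_norm H T = Sup ({0} \<union> {norm (T x) | x. x \<in> H \<and> norm x \<le> 1})"

definition contraction_on :: "'a::complex_inner set \<Rightarrow> ('a \<Rightarrow> 'a) \<Rightarrow> bool" where
  "contraction_on H T \<longleftrightarrow> bounded_op H H T \<and> (\<forall>x\<in>H. norm (T x) \<le> norm x)"

definition isometry_on :: "'a::complex_inner set \<Rightarrow> ('a \<Rightarrow> 'a) \<Rightarrow> bool" where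
  "isometry_on H V \<longleftrightarrow> bounded_op H H V \<and> (\<forall>x\<in>H. norm (V x) = norm x)"

definition unitary_on :: "'a::complex_inner set \<Rightarrow> ('a \<Rightarrow> 'a) \<Rightarrow> bool" where
  "unitary_on H U \<longleftrightarrow> isometry_on H U \<and> U ` H = H"

definition is_lifting :: "'a::complex_inner set \<Rightarrow> 'b::complex_inner set \<Rightarrow> ('a \<Rightarrow> 'b) \<Rightarrow> ('a \<Rightarrow> 'b) \<Rightarrow> bool" where
  "is_lifting H1 H2 T S \<longleftrightarrow>
     bounded_op UNIV UNIV S \<and>
     S ` orth_compl H1 \<subseteq> orth_compl H2 \<and>
     (\<forall>x\<in>H1. T x = orth_proj H2 (S x))"

definition isometric_lifting :: "'a::complex_inner set \<Rightarrow> ('a \<Rightarrow> 'a) \<Rightarrow> ('a \<Rightarrow> 'a) \<Rightarrow> bool" where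
  "isometric_lifting H T V \<longleftrightarrow> is_lifting H H T V \<and> isometry_on UNIV V"

definition reduces :: "'a::complex_inner set \<Rightarrow> ('a \<Rightarrow> 'a) \<Rightarrow> bool" where
  "reduces H A \<longleftrightarrow> A ` H \<subseteq> H \<and> A ` orth_compl H \<subseteq> orth_compl H"

end

theory Submission
  imports Defs
begin

text \<open>All three parts reduce to one commutant lifting statement: an isometric lifting \<open>V\<close> of \<open>T\<close>, a
  contractive lifting \<open>W\<close> of \<open>T'\<close> and \<open>X T = T' X\<close> give a lifting \<open>Y\<close> of \<open>X\<close> with \<open>Y V = W Y\<close> and the
  same norm. Parts (i) and (ii) are the cases \<open>W = Qb V2\<close> and \<open>W = V2 Qb\<close>; part (iii) is the case
  \<open>V = V1 Qb\<inverse>\<close>, \<open>W = V2\<close>.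

  The liftings of \<open>X\<close> of norm at most \<open>\<parallel>X\<parallel>\<close> form a convex set, compact in the weak operator topology.
  Given such a lifting \<open>Y\<close>, Parrott's lemma extends the contractive data \<open>V x \<mapsto> W (Y x)\<close> on the range
  of \<open>V\<close> to another such lifting \<open>Y'\<close>, so that \<open>Y' V = W Y\<close>. Iterating, the averages \<open>M\<close> of the first
  \<open>n\<close> iterates satisfy \<open>M V - W M = O(1/n)\<close>, and any weak cluster point of them intertwines.\<close>

section \<open>Positive semidefinite forms\<close>

text \<open>Serves two forms: the real part of the inner product, and the defect form in Parrott's
  lemma. The latter may vanish on nonzero vectors and need not be complete, so \<open>b\<close> is
  only semidefinite and no limits are taken in \<open>q\<close>.\<close>

locale semi_inner =
  fixes b :: "'a::real_vector \<Rightarrow> 'a \<Rightarrow> real"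
  assumes b_add: "b (x + y) z = b x z + b y z"
    and b_scale: "b (r *\<^sub>R x) z = r * b x z"
    and b_sym: "b x y = b y x"
    and b_nonneg: "0 \<le> b x x"
begin

definition q where "q x = sqrt (b x x)"

lemma b_scale_right: "b z (r *\<^sub>R x) = r * b z x"
  using b_scale b_sym by metis

lemma b_diff: "b (x - y) z = b x z - b y z"
  using b_add[of "x - y" y z] by simp

lemma b_diff_right: "b z (x - y) = b z x - b z y"
  using b_diff b_sym by metis

lemma q_ge_0: "0 \<le> q x"
  by (simp add: q_def b_nonneg)

lemma q_squared: "(q x)\<^sup>2 = b x x"
  by (simp add: q_def b_nonneg)

text \<open>The hypothesis bounds a quadratic polynomial in \<open>t\<close> from below; evaluating
  it at the minimiser \<open>t = b x s / b s s\<close> gives the estimate. With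
  \<open>e = q x\<close> the hypothesis is mere nonnegativity and the result is Cauchy-Schwarz; with
  small \<open>e\<close> it says that near-minimisers of distance are nearly orthogonal.\<close>

lemma almost_orthogonal:
  assumes min: "\<And>t::real. b x x - e\<^sup>2 \<le> b (x - t *\<^sub>R s) (x - t *\<^sub>R s)" and e: "0 \<le> e"
  shows "\<bar>b x s\<bar> \<le> e * q s"
proof -
  have quad: "2 * t * b x s \<le> e\<^sup>2 + t\<^sup>2 * b s s" for t
    using min[of t] b_sym[of s x]
    by (simp add: b_diff b_diff_right b_scale b_scale_right power2_eq_square algebra_simps)
  show ?thesis
  proof (cases "b s s = 0")
    case True
    have "b x s = 0"
    proof (rule ccontr)
      assume n: "b x s \<noteq> 0"
      \<comment> \<open>When \<open>b s s = 0\<close> the quadratic is linear in \<open>t\<close>,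
        so a nonzero slope lets it exceed \<open>e\<^sup>2\<close>; this \<open>t\<close> makes it
        \<open>2 * (e\<^sup>2 + 1)\<close>.\<close>
      have "2 * (e\<^sup>2 + 1) / b x s * b x s \<le> e\<^sup>2"
        using quad[of "(e\<^sup>2 + 1) / b x s"] True by simp
      then show False
        using n by (simp, smt (verit) zero_le_power2)
    qed
    then show ?thesis
      using True by (simp add: q_def)
  next
    case False
    then have p: "0 < b s s"
      using b_nonneg[of s] by simp
    have "2 * (b x s / b s s) * b x s \<le> e\<^sup>2 + (b x s / b s s)\<^sup>2 * b s s"
      by (rule quad)
    then have "(b x s)\<^sup>2 / b s s \<le> e\<^sup>2"
      using p by (simp add: power2_eq_square)
    then have "(b x s)\<^sup>2 \<le> (e * q s)\<^sup>2"
      using p by (simp add: power_mult_distrib q_squared field_simps)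
    then show ?thesis
      using e q_ge_0 by (metis abs_le_square_iff abs_of_nonneg mult_nonneg_nonneg)
  qed
qed

lemma Cauchy_Schwarz: "\<bar>b x y\<bar> \<le> q x * q y"
  by (rule almost_orthogonal) (simp_all add: q_squared b_nonneg q_ge_0)

lemma q_le_of_b_le:
  assumes "b x x \<le> e * q x" "0 \<le> e"
  shows "q x \<le> e"
  using assms q_squared[of x] q_ge_0[of x]
  by (metis mult_right_le_imp_le order_le_less power2_eq_square)

text \<open>Take \<open>r\<close> whose squared distance to \<open>x\<close> is within
  \<open>e\<^sup>2\<close> of the infimum. As \<open>R\<close> is a subspace, every
  \<open>r + t *\<^sub>R s\<close> competes for that infimum, so \<open>almost_orthogonal\<close>
  applies. Attaining the infimum would need completeness.\<close>

lemma approximate_projection: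
  assumes R: "0 \<in> R" "\<And>x y. x \<in> R \<Longrightarrow> y \<in> R \<Longrightarrow> x + y \<in> R"
    "\<And>r x. x \<in> R \<Longrightarrow> r *\<^sub>R x \<in> R"
    and e: "0 < e"
  shows "\<exists>r\<in>R. \<forall>s\<in>R. \<bar>b (x - r) s\<bar> \<le> e * q s"
proof -
  define d where "d = (INF r\<in>R. b (x - r) (x - r))"
  have bdd: "bdd_below ((\<lambda>r. b (x - r) (x - r)) ` R)"
    using b_nonneg by (auto intro!: bdd_belowI[of _ 0])
  have "d < d + e\<^sup>2"
    using e by simp
  then obtain r where r: "r \<in> R" "b (x - r) (x - r) < d + e\<^sup>2"
    unfolding d_def using bdd R(1) by (subst (asm) cINF_less_iff) auto
  have "\<bar>b (x - r) s\<bar> \<le> e * q s" if s: "s \<in> R" for s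
  proof (rule almost_orthogonal)
    fix t :: real
    have "r + t *\<^sub>R s \<in> R"
      using R r s by blast
    then have "d \<le> b (x - (r + t *\<^sub>R s)) (x - (r + t *\<^sub>R s))"
      unfolding d_def using bdd by (rule cINF_lower[rotated])
    then show "b (x - r) (x - r) - e\<^sup>2 \<le> b (x - r - t *\<^sub>R s) (x - r - t *\<^sub>R s)"
      using r(2) by (simp add: diff_diff_eq)
  qed (use e in simp)
  then show ?thesis
    using r(1) by blast
qed

lemma approximate_projection_seq:
  assumes R: "0 \<in> R" "\<And>x y. x \<in> R \<Longrightarrow> y \<in> R \<Longrightarrow> x + y \<in> R"
    "\<And>r x. x \<in> R \<Longrightarrow> r *\<^sub>R x \<in> R"
  obtains r :: "nat \<Rightarrow> 'a" and e :: "nat \<Rightarrow> real"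
  where "\<And>n. r n \<in> R" "\<And>n s. s \<in> R \<Longrightarrow> \<bar>b (x - r n) s\<bar> \<le> e n * q s"
    "e \<longlonglongrightarrow> 0" "\<And>n. 0 \<le> e n"
proof -
  have "\<forall>n. \<exists>r\<in>R. \<forall>s\<in>R. \<bar>b (x - r) s\<bar> \<le> inverse (real (Suc n)) * q s"
    using approximate_projection[OF R] by simp
  then obtain r where "\<And>n. r n \<in> R" "\<And>n s. s \<in> R \<Longrightarrow> \<bar>b (x - r n) s\<bar> \<le> inverse (real (Suc n)) * q s"
    by metis
  then show ?thesis
    using LIMSEQ_inverse_real_of_nat by (intro that[of r "\<lambda>n. inverse (real (Suc n))"]) auto
qed

end

section \<open>Complex inner product spaces\<close>

lemma scaleC_zero_right [simp]: "scaleC a (0::'a::complex_inner) = 0"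
  using scaleC_add_right[of a "0::'a" 0] by simp

lemma scaleC_zero_left [simp]: "scaleC 0 (x::'a::complex_inner) = 0"
  using scaleC_add_left[of 0 0 x] by simp

lemma scaleC_diff_right: "scaleC a (x - y :: 'a::complex_inner) = scaleC a x - scaleC a y"
  using scaleC_add_right[of a "x - y" y] by simp

lemma cinner_add_right: "cinner z (x + y :: 'a::complex_inner) = cinner z x + cinner z y"
  by (metis cinner_add_left cinner_commute complex_cnj_add)

lemma cinner_scaleC_right: "cinner z (scaleC a x :: 'a::complex_inner) = a * cinner z x"
  by (metis cinner_commute cinner_scaleC_left complex_cnj_cnj complex_cnj_mult)

lemma cinner_diff_left: "cinner (x - y) (z::'a::complex_inner) = cinner x z - cinner y z"
  using cinner_add_left[of "x - y" y z] by simp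

lemma cinner_diff_right: "cinner z (x - y :: 'a::complex_inner) = cinner z x - cinner z y"
  using cinner_add_right[of z "x - y" y] by simp

lemma cinner_zero_left [simp]: "cinner 0 (x::'a::complex_inner) = 0"
  using cinner_add_left[of 0 0 x] by simp

lemma cinner_zero_right [simp]: "cinner (x::'a::complex_inner) 0 = 0"
  using cinner_add_right[of x 0 0] by simp

lemma cinner_eq_zero_iff [simp]: "cinner x x = 0 \<longleftrightarrow> (x::'a::complex_inner) = 0"
  by (simp add: cinner_self_norm)

lemma cinner_zero_commute: "cinner x y = 0 \<longleftrightarrow> cinner y (x::'a::complex_inner) = 0"
  by (metis cinner_commute complex_cnj_zero)

lemma norm_scaleC: "norm (scaleC a (x::'a::complex_inner)) = cmod a * norm x"
proof -
  have "complex_of_real ((norm (scaleC a x))\<^sup>2) = a * cnj a * complex_of_real ((norm x)\<^sup>2)"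
    by (simp only: cinner_self_norm[symmetric] cinner_scaleC_left cinner_scaleC_right mult_ac)
  also have "\<dots> = complex_of_real ((cmod a * norm x)\<^sup>2)"
    using complex_norm_square[of a] by (simp add: power_mult_distrib)
  finally have "(norm (scaleC a x))\<^sup>2 = (cmod a * norm x)\<^sup>2"
    using of_real_eq_iff by blast
  then show ?thesis
    by simp
qed

text \<open>Facts about the complex inner product are recovered from its real part by multiplying
  one argument by a phase or by the imaginary unit.\<close>

interpretation cin: semi_inner "\<lambda>x y::'a::complex_inner. Re (cinner x y)"
  rewrites "semi_inner.q (\<lambda>x y::'a. Re (cinner x y)) = norm"
proof -
  show *: "semi_inner (\<lambda>x y::'a. Re (cinner x y))"
  proof
    fix x y z :: 'a and r :: real
    show "Re (cinner (x + y) z) = Re (cinner x z) + Re (cinner y z)"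
      by (simp add: cinner_add_left)
    show "Re (cinner (r *\<^sub>R x) z) = r * Re (cinner x z)"
      by (simp add: scaleC_of_real[symmetric] cinner_scaleC_left)
    show "Re (cinner x y) = Re (cinner y x)"
      by (subst cinner_commute) simp
    show "0 \<le> Re (cinner x x)"
      by (simp add: cinner_self_norm)
  qed
  show "semi_inner.q (\<lambda>x y::'a. Re (cinner x y)) = norm"
    by (rule ext) (simp add: semi_inner.q_def[OF *] cinner_self_norm)
qed

lemma cmod_cinner_le: "cmod (cinner x (y::'a::complex_inner)) \<le> norm x * norm y"
proof (cases "cinner x y = 0")
  case False
  \<comment> \<open>A phase of modulus one that rotates \<open>cinner x y\<close> onto the
    nonnegative real axis, where the real Cauchy-Schwarz inequality sees its full modulus.\<close>
  define a where "a = cnj (sgn (cinner x y))"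
  have "cinner x (scaleC a y) = complex_of_real (cmod (cinner x y))"
    using False by (simp add: a_def cinner_scaleC_right sgn_eq complex_norm_square[symmetric] power2_eq_square
        mult.commute[of "cnj _"])
  moreover have "cmod a = 1"
    using False by (simp add: a_def norm_sgn)
  ultimately show ?thesis
    using cin.Cauchy_Schwarz[of x "scaleC a y"] by (simp add: norm_scaleC)
qed simp

lemma Re_cinner_self: "Re (cinner x (x::'a::complex_inner)) = (norm x)\<^sup>2"
  by (simp add: cinner_self_norm)

lemma norm_add_squared:
  "(norm (x + y :: 'a::complex_inner))\<^sup>2 = (norm x)\<^sup>2 + 2 * Re (cinner x y) + (norm y)\<^sup>2"
  using cin.b_sym[of x y]
  by (simp add: Re_cinner_self[symmetric] cinner_add_left cinner_add_right)

lemma bounded_linear_cinner_right: "bounded_linear (cinner (x::'a::complex_inner))"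
  by (rule bounded_linear_intro[where K = "norm x"])
    (simp_all add: cinner_add_right scaleC_of_real[symmetric] cinner_scaleC_right scaleR_conv_of_real
      cmod_cinner_le mult.commute[of _ "norm x"])

lemmas tendsto_cinner_right = bounded_linear.tendsto[OF bounded_linear_cinner_right]

lemma bounded_linear_scaleC: "bounded_linear (scaleC a :: 'a::complex_inner \<Rightarrow> 'a)"
  by (rule bounded_linear_intro[where K = "cmod a"])
    (simp_all add: scaleC_add_right scaleC_of_real[symmetric] scaleC_scaleC norm_scaleC mult.commute)

lemmas tendsto_scaleC = bounded_linear.tendsto[OF bounded_linear_scaleC]

lemma cinner_eqI:
  assumes "\<And>y. cinner y x = cinner y (x'::'a::complex_inner)"
  shows "x = x'"
  using assms[of "x - x'"] by (metis cinner_diff_right cinner_eq_zero_iff right_minus_eq)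

section \<open>Orthogonal projections and the Riesz representation\<close>

lemma csubspace_scaleR:
  assumes "csubspace S" "x \<in> S"
  shows "r *\<^sub>R x \<in> S"
  using assms unfolding csubspace_def by (metis scaleC_of_real)

lemma csubspace_diff:
  assumes "csubspace S" "x \<in> S" "y \<in> S"
  shows "x - y \<in> S"
  using assms csubspace_scaleR[of S y "- 1"] unfolding csubspace_def
  by (metis diff_conv_add_uminus scaleR_minus1_left)

lemma csubspace_orth_compl: "csubspace (orth_compl S)"
  by (simp add: csubspace_def orth_compl_def cinner_add_right cinner_scaleC_right)

lemma orth_compl_closed_seq:
  assumes "\<And>n. f n \<in> orth_compl S" "f \<longlonglongrightarrow> l"
  shows "l \<in> orth_compl S"
proof -
  have "cinner x l = 0" if "x \<in> S" for x
  proof -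
    have "(\<lambda>n. cinner x (f n)) \<longlonglongrightarrow> cinner x l"
      by (rule tendsto_cinner_right[OF assms(2)])
    then show ?thesis
      using assms(1) that by (simp add: orth_compl_def LIMSEQ_const_iff)
  qed
  then show ?thesis
    by (simp add: orth_compl_def)
qed

lemma in_csubspace_and_orth_compl:
  assumes "x \<in> S" "x \<in> orth_compl S"
  shows "x = (0::'a::complex_inner)"
  using assms by (auto simp: orth_compl_def)

text \<open>Replacing \<open>s\<close> by \<open>scaleC \<i> s\<close>, which stays in
  \<open>S\<close>, turns the imaginary part into a real part.\<close>

lemma orth_compl_from_Re:
  assumes "csubspace S" "\<And>s. s \<in> S \<Longrightarrow> Re (cinner x s) = 0"
  shows "x \<in> orth_compl S"
proof -
  have "cinner s x = 0" if s: "s \<in> S" for s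
  proof -
    have "scaleC \<i> s \<in> S"
      using assms(1) s by (simp add: csubspace_def)
    then have "Re (cinner x (scaleC \<i> s)) = 0"
      by (rule assms(2))
    then have "cinner x s = 0"
      using assms(2)[OF s] by (simp add: cinner_scaleC_right complex_eq_iff)
    then show ?thesis
      using cinner_zero_commute by blast
  qed
  then show ?thesis
    by (simp add: orth_compl_def)
qed

text \<open>The difference of two approximate projections lies in \<open>H\<close>, so it may be
  tested against its own residuals; its norm is then at most the sum of the two errors. The sequence
  is therefore Cauchy, and its limit has residual orthogonal to \<open>H\<close>.\<close>

lemma projection_exists:
  fixes H :: "'a::chilbert set"
  assumes "closed_csubspace H"
  shows "\<exists>p\<in>H. x - p \<in> orth_compl H"
proof -
  have H: "csubspace H" "closed H"
    using assms by (auto simp: closed_csubspace_def)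
  have sub: "0 \<in> H" "\<And>x y. x \<in> H \<Longrightarrow> y \<in> H \<Longrightarrow> x + y \<in> H" "\<And>r x. x \<in> H \<Longrightarrow> r *\<^sub>R x \<in> H"
    using H(1) csubspace_scaleR by (auto simp: csubspace_def)
  obtain r e where r: "\<And>n. r n \<in> H" "\<And>n s. s \<in> H \<Longrightarrow> \<bar>Re (cinner (x - r n) s)\<bar> \<le> e n * norm s"
    and e: "e \<longlonglongrightarrow> 0" "\<And>n. 0 \<le> e n"
    by (rule cin.approximate_projection_seq[OF sub, of x]) blast+
  have dist: "norm (r m - r n) \<le> e m + e n" for m n
  proof (rule cin.q_le_of_b_le)
    have mem: "r m - r n \<in> H"
      using csubspace_diff[OF H(1)] r(1) by blast
    have "Re (cinner (r m - r n) (r m - r n))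
        = Re (cinner (x - r n) (r m - r n)) - Re (cinner (x - r m) (r m - r n))"
      by (simp add: cinner_diff_left)
    also have "\<dots> \<le> (e m + e n) * norm (r m - r n)"
      using r(2)[OF mem, of m] r(2)[OF mem, of n] by (simp add: algebra_simps)
    finally show "Re (cinner (r m - r n) (r m - r n)) \<le> (e m + e n) * norm (r m - r n)" .
  qed (use e(2) in simp)
  have "Cauchy r"
  proof (rule metric_CauchyI)
    fix \<epsilon> :: real
    assume "0 < \<epsilon>"
    then have "\<forall>\<^sub>F n in sequentially. e n < \<epsilon> / 2"
      by (intro order_tendstoD(2)[OF e(1)]) simp
    then obtain N where N: "\<And>n. n \<ge> N \<Longrightarrow> e n < \<epsilon> / 2"
      unfolding eventually_sequentially by blast
    have "dist (r m) (r n) < \<epsilon>" if "m \<ge> N" "n \<ge> N" for m n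
      using dist[of m n] N[OF that(1)] N[OF that(2)] by (simp add: dist_norm)
    then show "\<exists>M. \<forall>m\<ge>M. \<forall>n\<ge>M. dist (r m) (r n) < \<epsilon>"
      by blast
  qed
  then obtain p where p: "r \<longlonglongrightarrow> p"
    by (auto simp: Cauchy_convergent_iff convergent_def)
  have "p \<in> H"
    using H(2) r(1) p closed_sequentially by blast
  moreover have "x - p \<in> orth_compl H"
  proof (rule orth_compl_from_Re[OF H(1)])
    fix s assume s: "s \<in> H"
    have "(\<lambda>n. Re (cinner s (x - r n))) \<longlonglongrightarrow> Re (cinner s (x - p))"
      by (intro tendsto_Re tendsto_cinner_right tendsto_intros p)
    moreover have "(\<lambda>n. Re (cinner s (x - r n))) \<longlonglongrightarrow> 0"
    proof (rule Lim_null_comparison)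
      show "\<forall>\<^sub>F n in sequentially. norm (Re (cinner s (x - r n))) \<le> e n * norm s"
        using r(2)[OF s] by (subst cin.b_sym) simp
      show "(\<lambda>n. e n * norm s) \<longlonglongrightarrow> 0"
        using tendsto_mult_left_zero[OF e(1)] .
    qed
    ultimately have "Re (cinner s (x - p)) = 0"
      by (rule LIMSEQ_unique)
    then show "Re (cinner (x - p) s) = 0"
      by (subst cin.b_sym)
  qed
  ultimately show ?thesis
    by blast
qed

text \<open>Unfolds the definite description: two candidates differ by a vector in both
  \<open>H\<close> and its complement. Later identities for projections come from exhibiting the
  right candidate.\<close>

lemma orth_proj_eqI:
  fixes H :: "'a::chilbert set"
  assumes "closed_csubspace H" "p \<in> H" "x - p \<in> orth_compl H"
  shows "orth_proj H x = p"
  unfolding orth_proj_def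
proof (rule the_equality)
  fix p' assume p': "p' \<in> H \<and> x - p' \<in> orth_compl H"
  have sub: "csubspace H"
    using assms(1) by (simp add: closed_csubspace_def)
  have "p' - p \<in> H"
    using csubspace_diff[OF sub] p' assms by blast
  moreover have "p' - p \<in> orth_compl H"
    using csubspace_diff[OF csubspace_orth_compl assms(3), of "x - p'"] p' by simp
  ultimately show "p' = p"
    using in_csubspace_and_orth_compl by fastforce
qed (use assms in simp)

lemma
  fixes H :: "'a::chilbert set"
  assumes "closed_csubspace H"
  shows orth_proj_in: "orth_proj H x \<in> H"
    and orth_proj_residual: "x - orth_proj H x \<in> orth_compl H"
  using projection_exists[OF assms, of x] orth_proj_eqI[OF assms] by auto

lemma norm_orth_proj_le:
  fixes H :: "'a::chilbert set"
  assumes "closed_csubspace H"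
  shows "norm (orth_proj H x) \<le> norm x"
proof -
  have "cinner (orth_proj H x) (x - orth_proj H x) = 0"
    using orth_proj_in[OF assms] orth_proj_residual[OF assms] by (simp add: orth_compl_def)
  then have "(norm x)\<^sup>2 = (norm (orth_proj H x))\<^sup>2 + (norm (x - orth_proj H x))\<^sup>2"
    using norm_add_squared[of "orth_proj H x" "x - orth_proj H x"] by simp
  then show ?thesis
    by (intro power2_le_imp_le[OF _ norm_ge_zero]) simp
qed

lemma orth_proj_add:
  fixes H :: "'a::chilbert set"
  assumes H: "closed_csubspace H"
  shows "orth_proj H (x + y) = orth_proj H x + orth_proj H y"
proof (rule orth_proj_eqI[OF H])
  show "orth_proj H x + orth_proj H y \<in> H"
    using H orth_proj_in[OF H] by (simp add: closed_csubspace_def csubspace_def)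
  have "(x - orth_proj H x) + (y - orth_proj H y) \<in> orth_compl H"
    using csubspace_orth_compl[of H] orth_proj_residual[OF H] unfolding csubspace_def by blast
  then show "x + y - (orth_proj H x + orth_proj H y) \<in> orth_compl H"
    by (simp add: algebra_simps)
qed

lemma orth_proj_scaleC:
  fixes H :: "'a::chilbert set"
  assumes H: "closed_csubspace H"
  shows "orth_proj H (scaleC a x) = scaleC a (orth_proj H x)"
proof (rule orth_proj_eqI[OF H])
  show "scaleC a (orth_proj H x) \<in> H"
    using H orth_proj_in[OF H] by (simp add: closed_csubspace_def csubspace_def)
  have "scaleC a (x - orth_proj H x) \<in> orth_compl H"
    using csubspace_orth_compl[of H] orth_proj_residual[OF H] unfolding csubspace_def by blast
  then show "scaleC a x - scaleC a (orth_proj H x) \<in> orth_compl H"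
    by (simp add: scaleC_diff_right)
qed

text \<open>Pick \<open>v\<close> orthogonal to the kernel with nonzero value. For every
  \<open>x\<close> the vector \<open>scaleC (\<phi> v) x - scaleC (\<phi> x) v\<close> lies in the
  kernel, hence is orthogonal to \<open>v\<close>; solving that equation for \<open>\<phi> x\<close>
  gives the representing vector.\<close>

lemma riesz_representation:
  fixes \<phi> :: "'a::chilbert \<Rightarrow> complex"
  assumes add: "\<And>x y. \<phi> (x + y) = \<phi> x + \<phi> y" and scale: "\<And>a x. \<phi> (scaleC a x) = a * \<phi> x"
    and bound: "\<And>x. cmod (\<phi> x) \<le> C * norm x"
  shows "\<exists>z. \<forall>x. \<phi> x = cinner z x"
proof (cases "\<forall>x. \<phi> x = 0")
  case True
  then show ?thesis
    by (intro exI[of _ 0]) simp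
next
  case False
  then obtain u where u: "\<phi> u \<noteq> 0"
    by blast
  define N where "N = {x. \<phi> x = 0}"
  have "bounded_linear \<phi>"
    using bound by (intro bounded_linear_intro[where K = C])
      (simp_all add: add scale scaleC_of_real[symmetric] scaleR_conv_of_real mult.commute)
  then have "continuous_on UNIV \<phi>"
    by (rule linear_continuous_on)
  then have "closed N"
    unfolding N_def by (intro closed_Collect_eq) simp_all
  moreover have "\<phi> 0 = 0"
    using add[of 0 0] by simp
  ultimately have N: "closed_csubspace N"
    by (simp add: N_def closed_csubspace_def csubspace_def add scale)
  define v where "v = u - orth_proj N u"
  have v: "v \<in> orth_compl N"
    using orth_proj_residual[OF N] by (simp add: v_def)
  have "\<phi> u = \<phi> v + \<phi> (orth_proj N u)"
    by (simp add: v_def add[symmetric])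
  then have \<phi>v: "\<phi> v \<noteq> 0"
    using u orth_proj_in[OF N, of u] by (simp add: N_def)
  then have v0: "cinner v v \<noteq> 0"
    using \<open>\<phi> 0 = 0\<close> by auto
  have "\<phi> x = cinner (scaleC (cnj (\<phi> v / cinner v v)) v) x" for x
  proof -
    have "\<phi> (scaleC (\<phi> v) x - scaleC (\<phi> x) v) + \<phi> (scaleC (\<phi> x) v) = \<phi> (scaleC (\<phi> v) x)"
      by (simp add: add[symmetric])
    then have "scaleC (\<phi> v) x - scaleC (\<phi> x) v \<in> N"
      by (simp add: N_def scale mult.commute)
    then have "cinner v (scaleC (\<phi> v) x - scaleC (\<phi> x) v) = 0"
      using v cinner_zero_commute unfolding orth_compl_def by blast
    then have "\<phi> v * cinner v x = \<phi> x * cinner v v"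
      by (simp add: cinner_diff_right cinner_scaleC_right)
    then show ?thesis
      using v0 by (simp add: cinner_scaleC_left field_simps)
  qed
  then show ?thesis
    by blast
qed

section \<open>Extending contractions\<close>

text \<open>The extension is \<^term>\<open>D\<close> composed with the \<^term>\<open>b\<close>-orthogonal projection onto the
  \<^term>\<open>b\<close>-closure of \<^term>\<open>R\<close>. Since \<^term>\<open>b\<close> may be degenerate and not complete, the projection is
  replaced by sequences of approximate projections, whose images under \<^term>\<open>D\<close> converge.\<close>

lemma extend_semi_contraction:
  fixes b :: "'a::complex_inner \<Rightarrow> 'a \<Rightarrow> real" and D :: "'a \<Rightarrow> 'b::chilbert"
  assumes "semi_inner b" and rot: "\<And>a x y. b (scaleC a x) y = b x (scaleC (cnj a) y)"
    and R: "csubspace R"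
    and D_add: "\<And>x y. x \<in> R \<Longrightarrow> y \<in> R \<Longrightarrow> D (x + y) = D x + D y"
    and D_scale: "\<And>a x. x \<in> R \<Longrightarrow> D (scaleC a x) = scaleC a (D x)"
    and D_le: "\<And>x. x \<in> R \<Longrightarrow> (norm (D x))\<^sup>2 \<le> b x x"
  obtains E where "\<And>x y. E (x + y) = E x + E y" "\<And>a x. E (scaleC a x) = scaleC a (E x)"
    "\<And>x. (norm (E x))\<^sup>2 \<le> b x x" "\<And>x. x \<in> R \<Longrightarrow> E x = D x"
    "\<And>x. \<exists>f. (\<forall>n. f n \<in> R) \<and> (\<lambda>n. D (f n)) \<longlonglongrightarrow> E x"
proof -
  interpret semi_inner b by fact
  have R_sub: "0 \<in> R" "\<And>x y. x \<in> R \<Longrightarrow> y \<in> R \<Longrightarrow> x + y \<in> R" "\<And>r x. x \<in> R \<Longrightarrow> r *\<^sub>R x \<in> R"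
    using R csubspace_scaleR by (auto simp: csubspace_def)
  have R_scale: "scaleC a x \<in> R" if "x \<in> R" for a x
    using R that by (simp add: csubspace_def)
  note R_diff = csubspace_diff[OF R]
  have D_diff: "D (x - y) = D x - D y" if "x \<in> R" "y \<in> R" for x y
    using D_add[OF R_diff[OF that] that(2)] by simp
  have D_q: "norm (D x) \<le> q x" if "x \<in> R" for x
    using D_le[OF that] by (intro power2_le_imp_le[OF _ q_ge_0]) (simp add: q_squared)
  \<comment> \<open>Moving both scalars to one side of \<open>b\<close> by \<open>rot\<close> leaves
    the real scalar \<open>(cmod a)\<^sup>2\<close>, to which real homogeneity applies.\<close>
  have q_scale: "q (scaleC a x) = cmod a * q x" for a x
  proof -
    have "(q (scaleC a x))\<^sup>2 = b x (scaleC (complex_of_real ((cmod a)\<^sup>2)) x)"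
      by (simp only: q_squared rot scaleC_scaleC complex_norm_square mult.commute[of "cnj a"])
    also have "\<dots> = (cmod a * q x)\<^sup>2"
      by (simp only: scaleC_of_real b_scale_right power_mult_distrib q_squared)
    finally show ?thesis
      by (simp add: q_ge_0)
  qed
  define approx where "approx x r e \<longleftrightarrow> (\<forall>n::nat. r n \<in> R) \<and>
    (\<forall>n. \<forall>s\<in>R. \<bar>b (x - r n) s\<bar> \<le> e n * q s) \<and> e \<longlonglongrightarrow> 0 \<and> (\<forall>n. 0 \<le> e n)" for x r e
  have exists: "\<exists>r e. approx x r e" for x
  proof -
    obtain r e where "\<And>n. r n \<in> R" "\<And>n s. s \<in> R \<Longrightarrow> \<bar>b (x - r n) s\<bar> \<le> e n * q s"
      "e \<longlonglongrightarrow> 0" "\<And>n. 0 \<le> e n"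
      by (rule approximate_projection_seq[OF R_sub, of x]) blast+
    then show ?thesis
      unfolding approx_def by blast
  qed
  \<comment> \<open>Two possibly different approximating sequences of the same \<open>x\<close> are
    compared. Taking them equal gives the Cauchy property; taking them different shows that the
    limit does not depend on the choice.\<close>
  have close: "norm (D (r m) - D (r' n)) \<le> e m + e' n"
    if a: "approx x r e" and a': "approx x r' e'" for x r r' e e' m n
  proof -
    have mem: "r m - r' n \<in> R"
      using a a' R_diff by (simp add: approx_def)
    have "q (r m - r' n) \<le> e m + e' n"
    proof (rule q_le_of_b_le)
      have "b (r m - r' n) (r m - r' n) = b (x - r' n) (r m - r' n) - b (x - r m) (r m - r' n)"
        by (simp add: b_diff)
      moreover have "\<bar>b (x - r' n) (r m - r' n)\<bar> \<le> e' n * q (r m - r' n)"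
        "\<bar>b (x - r m) (r m - r' n)\<bar> \<le> e m * q (r m - r' n)"
        using a a' mem by (auto simp: approx_def)
      ultimately show "b (r m - r' n) (r m - r' n) \<le> (e m + e' n) * q (r m - r' n)"
        by (simp add: distrib_right)
      show "0 \<le> e m + e' n"
        using a a' by (simp add: approx_def)
    qed
    moreover have "D (r m - r' n) = D (r m) - D (r' n)"
      using a a' by (intro D_diff) (simp_all add: approx_def)
    ultimately show ?thesis
      using D_q[OF mem] by simp
  qed
  have conv: "\<exists>y. (\<lambda>n. D (r n)) \<longlonglongrightarrow> y" if a: "approx x r e" for x r e
  proof -
    have "Cauchy (\<lambda>n. D (r n))"
    proof (rule metric_CauchyI)
      fix \<epsilon> :: real
      assume "0 < \<epsilon>"
      then have "\<forall>\<^sub>F n in sequentially. e n < \<epsilon> / 2"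
        using a by (intro order_tendstoD(2)[of e 0]) (simp_all add: approx_def)
      then obtain N where N: "\<And>n. n \<ge> N \<Longrightarrow> e n < \<epsilon> / 2"
        unfolding eventually_sequentially by blast
      have "dist (D (r m)) (D (r n)) < \<epsilon>" if "m \<ge> N" "n \<ge> N" for m n
        using close[OF a a, of m n] N[OF that(1)] N[OF that(2)] by (simp add: dist_norm)
      then show "\<exists>M. \<forall>m\<ge>M. \<forall>n\<ge>M. dist (D (r m)) (D (r n)) < \<epsilon>"
        by blast
    qed
    then show ?thesis
      by (auto simp: Cauchy_convergent_iff convergent_def)
  qed
  \<comment> \<open>\<open>P\<close> is the graph of the extension. Since it is single-valued, each
    algebraic property of \<open>E\<close> follows by exhibiting one approximating sequence with the
    desired limit.\<close>
  define P where "P x y \<longleftrightarrow> (\<exists>r e. approx x r e \<and> (\<lambda>n. D (r n)) \<longlonglongrightarrow> y)" for x y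
  have unique: "y = y'" if P: "P x y" "P x y'" for x y y'
  proof -
    obtain r e r' e' where a: "approx x r e" "(\<lambda>n. D (r n)) \<longlonglongrightarrow> y"
      and a': "approx x r' e'" "(\<lambda>n. D (r' n)) \<longlonglongrightarrow> y'"
      using P by (auto simp: P_def)
    have "(\<lambda>n. e n + e' n) \<longlonglongrightarrow> 0 + 0"
      using a(1) a'(1) by (intro tendsto_add) (auto simp: approx_def)
    then have e0: "(\<lambda>n. e n + e' n) \<longlonglongrightarrow> 0"
      by simp
    have "(\<lambda>n. D (r n) - D (r' n)) \<longlonglongrightarrow> 0"
      by (rule Lim_null_comparison[OF _ e0]) (simp add: close[OF a(1) a'(1)])
    moreover have "(\<lambda>n. D (r n) - D (r' n)) \<longlonglongrightarrow> y - y'"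
      by (intro tendsto_diff a a')
    ultimately show ?thesis
      using LIMSEQ_unique by fastforce
  qed
  have "\<exists>y. P x y" for x
    using exists[of x] conv unfolding P_def by blast
  then obtain E where E: "\<And>x. P x (E x)"
    by metis
  show ?thesis
  proof (rule that)
    fix x y
    obtain r e r' e' where a: "approx x r e" "(\<lambda>n. D (r n)) \<longlonglongrightarrow> E x"
      and a': "approx y r' e'" "(\<lambda>n. D (r' n)) \<longlonglongrightarrow> E y"
      using E[of x] E[of y] by (auto simp: P_def)
    have "approx (x + y) (\<lambda>n. r n + r' n) (\<lambda>n. e n + e' n)"
      unfolding approx_def
    proof (intro conjI allI ballI)
      fix n s
      assume s: "s \<in> R"
      have "b (x + y - (r n + r' n)) s = b (x - r n) s + b (y - r' n) s"
        by (simp add: b_diff b_add)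
      moreover have "\<bar>b (x - r n) s\<bar> \<le> e n * q s" "\<bar>b (y - r' n) s\<bar> \<le> e' n * q s"
        using a a' s by (auto simp: approx_def)
      ultimately show "\<bar>b (x + y - (r n + r' n)) s\<bar> \<le> (e n + e' n) * q s"
        by (simp add: distrib_right)
    next
      show "(\<lambda>n. e n + e' n) \<longlonglongrightarrow> 0"
        using a(1) a'(1) tendsto_add[of e 0 _ e' 0] by (auto simp: approx_def)
    qed (use a a' R_sub in \<open>auto simp: approx_def\<close>)
    moreover have "(\<lambda>n. D (r n + r' n)) \<longlonglongrightarrow> E x + E y"
      using tendsto_add[OF a(2) a'(2)] a a' by (simp add: approx_def D_add)
    ultimately have "P (x + y) (E x + E y)"
      unfolding P_def by blast
    then show "E (x + y) = E x + E y"
      using unique E by blast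
  next
    fix c x
    obtain r e where a: "approx x r e" "(\<lambda>n. D (r n)) \<longlonglongrightarrow> E x"
      using E[of x] by (auto simp: P_def)
    have "approx (scaleC c x) (\<lambda>n. scaleC c (r n)) (\<lambda>n. cmod c * e n)"
      unfolding approx_def
    proof (intro conjI allI ballI)
      fix n s
      assume "s \<in> R"
      then have "\<bar>b (x - r n) (scaleC (cnj c) s)\<bar> \<le> e n * q (scaleC (cnj c) s)"
        using a R_scale by (simp add: approx_def)
      then show "\<bar>b (scaleC c x - scaleC c (r n)) s\<bar> \<le> cmod c * e n * q s"
        by (simp add: scaleC_diff_right[symmetric] rot q_scale mult_ac)
    next
      show "(\<lambda>n. cmod c * e n) \<longlonglongrightarrow> 0"
        using a(1) by (intro tendsto_mult_right_zero) (simp add: approx_def)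
    qed (use a R_scale in \<open>auto simp: approx_def\<close>)
    moreover have "(\<lambda>n. D (scaleC c (r n))) \<longlonglongrightarrow> scaleC c (E x)"
      using tendsto_scaleC[OF a(2), of c] a by (simp add: approx_def D_scale)
    ultimately have "P (scaleC c x) (scaleC c (E x))"
      unfolding P_def by blast
    then show "E (scaleC c x) = scaleC c (E x)"
      using unique E by blast
  next
    fix x
    obtain r e where a: "approx x r e" "(\<lambda>n. D (r n)) \<longlonglongrightarrow> E x"
      using E[of x] by (auto simp: P_def)
    \<comment> \<open>An approximate projection of \<open>x\<close> exceeds \<open>x\<close> in
      length by at most the error \<open>e n\<close>, as testing its residual against
      \<open>r n\<close> itself shows.\<close>
    have "norm (D (r n)) \<le> q x + e n" for n
    proof -
      have "q (r n) \<le> q x + e n"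
      proof (rule q_le_of_b_le)
        have "b (r n) (r n) = b x (r n) - b (x - r n) (r n)"
          by (simp add: b_diff)
        moreover have "\<bar>b (x - r n) (r n)\<bar> \<le> e n * q (r n)"
          using a by (simp add: approx_def)
        ultimately show "b (r n) (r n) \<le> (q x + e n) * q (r n)"
          using Cauchy_Schwarz[of x "r n"] by (simp add: distrib_right)
        show "0 \<le> q x + e n"
          using a q_ge_0 by (simp add: approx_def)
      qed
      moreover have "norm (D (r n)) \<le> q (r n)"
        using a by (intro D_q) (simp add: approx_def)
      ultimately show ?thesis
        by simp
    qed
    moreover have "(\<lambda>n. q x + e n) \<longlonglongrightarrow> q x + 0"
      using a(1) by (intro tendsto_intros) (simp add: approx_def)
    moreover have "(\<lambda>n. norm (D (r n))) \<longlonglongrightarrow> norm (E x)"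
      by (intro tendsto_norm a)
    ultimately have "norm (E x) \<le> q x + 0"
      using LIMSEQ_le by blast
    then show "(norm (E x))\<^sup>2 \<le> b x x"
      using power_mono[of "norm (E x)" "q x" 2] by (simp add: q_squared)
    show "\<exists>f. (\<forall>n. f n \<in> R) \<and> (\<lambda>n. D (f n)) \<longlonglongrightarrow> E x"
      using a by (auto simp: approx_def)
  next
    fix x
    assume "x \<in> R"
    moreover have "b 0 s = 0" for s
      using b_diff[of 0 0 s] by simp
    \<comment> \<open>A vector of \<open>R\<close> is its own projection: the constant sequence has
      zero error.\<close>
    ultimately have "approx x (\<lambda>n. x) (\<lambda>n. 0)"
      by (simp add: approx_def)
    then have "P x (D x)"
      unfolding P_def by (intro exI[of _ "\<lambda>n. x"] exI[of _ "\<lambda>n. 0"] conjI tendsto_const)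
    then show "E x = D x"
      using unique E by blast
  qed
qed

lemma norm_add_squared_orth:
  assumes "cinner x (y::'a::complex_inner) = 0"
  shows "(norm (x + y))\<^sup>2 = (norm x)\<^sup>2 + (norm y)\<^sup>2"
  by (simp add: norm_add_squared assms)

text \<open>This is Parrott's lemma: \<^term>\<open>G\<close> prescribes the component of the extension in \<^term>\<open>H\<close>.\<close>

lemma parrott_extension:
  fixes G S :: "'a::complex_inner \<Rightarrow> 'b::chilbert"
  assumes R: "csubspace R"
    and S_add: "\<And>x y. x \<in> R \<Longrightarrow> y \<in> R \<Longrightarrow> S (x + y) = S x + S y"
    and S_scale: "\<And>a x. x \<in> R \<Longrightarrow> S (scaleC a x) = scaleC a (S x)"
    and S_le: "\<And>x. x \<in> R \<Longrightarrow> norm (S x) \<le> c * norm x"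
    and G_in: "\<And>x. G x \<in> H"
    and G_add: "\<And>x y. G (x + y) = G x + G y"
    and G_scale: "\<And>a x. G (scaleC a x) = scaleC a (G x)"
    and G_le: "\<And>x. norm (G x) \<le> c * norm x"
    and SG: "\<And>x. x \<in> R \<Longrightarrow> S x - G x \<in> orth_compl H"
    and c: "0 \<le> c"
  obtains Y where "\<And>x y. Y (x + y) = Y x + Y y" "\<And>a x. Y (scaleC a x) = scaleC a (Y x)"
    "\<And>x. norm (Y x) \<le> c * norm x" "\<And>x. x \<in> R \<Longrightarrow> Y x = S x" "\<And>x. Y x - G x \<in> orth_compl H"
proof -
  \<comment> \<open>The form of the defect operator \<open>c\<^sup>2 - G\<^sup>* G\<close>: it
    measures the room that the component in \<open>H\<close> leaves for the component orthogonal to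
    \<open>H\<close>.\<close>
  define b where "b x y = c\<^sup>2 * Re (cinner x y) - Re (cinner (G x) (G y))" for x y
  have G_scaleR: "G (r *\<^sub>R x) = r *\<^sub>R G x" for r x
    by (simp add: G_scale scaleC_of_real[symmetric])
  have b_self: "b x x = (c * norm x)\<^sup>2 - (norm (G x))\<^sup>2" for x
    by (simp add: b_def Re_cinner_self power_mult_distrib)
  have semi: "semi_inner b"
  proof
    fix x y z r
    show "b (x + y) z = b x z + b y z"
      by (simp add: b_def G_add cinner_add_left algebra_simps)
    show "b (r *\<^sub>R x) z = r * b x z"
      by (simp add: b_def G_scaleR cin.b_scale algebra_simps)
    show "b x y = b y x"
      unfolding b_def using cin.b_sym[of x y] cin.b_sym[of "G x" "G y"] by simp
    show "0 \<le> b x x"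
      using G_le[of x] by (simp add: b_self power_mono)
  qed
  have rot: "b (scaleC a x) y = b x (scaleC (cnj a) y)" for a x y
    by (simp add: b_def G_scale cinner_scaleC_left cinner_scaleC_right)
  have pyth: "(norm z)\<^sup>2 = (norm (G x))\<^sup>2 + (norm (z - G x))\<^sup>2" if "z - G x \<in> orth_compl H" for x z
    using norm_add_squared_orth[of "G x" "z - G x"] that G_in by (simp add: orth_compl_def)
  \<comment> \<open>By Pythagoras, the bound on \<open>S\<close> leaves at most
    \<open>(c * norm x)\<^sup>2 - (norm (G x))\<^sup>2\<close> for the part orthogonal to
    \<open>H\<close>, and that is \<open>b x x\<close>.\<close>
  have D_le: "(norm (S x - G x))\<^sup>2 \<le> b x x" if x: "x \<in> R" for x
  proof -
    have "(norm (S x))\<^sup>2 \<le> (c * norm x)\<^sup>2"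
      by (intro power_mono S_le x) simp
    then show ?thesis
      using pyth[OF SG[OF x]] by (simp add: b_self)
  qed
  have D_add: "S (x + y) - G (x + y) = S x - G x + (S y - G y)" if "x \<in> R" "y \<in> R" for x y
    using that by (simp add: S_add G_add)
  have D_scale: "S (scaleC a x) - G (scaleC a x) = scaleC a (S x - G x)" if "x \<in> R" for a x
    using that by (simp add: S_scale G_scale scaleC_diff_right)
  obtain E where E: "\<And>x y. E (x + y) = E x + E y" "\<And>a x. E (scaleC a x) = scaleC a (E x)"
    "\<And>x. (norm (E x))\<^sup>2 \<le> b x x" "\<And>x. x \<in> R \<Longrightarrow> E x = S x - G x"
    "\<And>x. \<exists>f. (\<forall>n. f n \<in> R) \<and> (\<lambda>n. S (f n) - G (f n)) \<longlonglongrightarrow> E x"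
    by (rule extend_semi_contraction[OF semi rot R D_add D_scale D_le]) blast+
  \<comment> \<open>The values of \<open>E\<close> are limits of vectors in the closed complement;
    the extension lemma records approximating sequences for this purpose.\<close>
  have E_orth: "E x \<in> orth_compl H" for x
  proof -
    obtain f where f: "\<And>n. f n \<in> R" "(\<lambda>n. S (f n) - G (f n)) \<longlonglongrightarrow> E x"
      using E(5)[of x] by blast
    show ?thesis
      by (rule orth_compl_closed_seq[OF SG[OF f(1)] f(2)])
  qed
  show ?thesis
  proof (rule that[of "\<lambda>x. G x + E x"])
    fix x
    have "(norm (G x + E x))\<^sup>2 \<le> (c * norm x)\<^sup>2"
      using pyth[of "G x + E x" x] E_orth E(3)[of x] by (simp add: b_self)
    then show "norm (G x + E x) \<le> c * norm x"
      by (rule power2_le_imp_le) (simp add: c)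
  qed (use E_orth in \<open>simp_all add: E G_add G_scale scaleC_add_right\<close>)
qed

section \<open>Weak operator compactness\<close>

lemma bounded_op_UNIV_intro:
  assumes "\<And>x y. Y (x + y) = Y x + Y y" "\<And>a x. Y (scaleC a x) = scaleC a (Y x)"
    "\<And>x. norm (Y x) \<le> c * norm x"
  shows "bounded_op UNIV UNIV Y"
  using assms by (auto simp: bounded_op_def)

lemma bounded_op_UNIV_D:
  assumes "bounded_op UNIV UNIV Y"
  shows "Y (x + y) = Y x + Y y" "Y (scaleC a x) = scaleC a (Y x)" "Y 0 = 0" "Y (x - y) = Y x - Y y"
    "\<exists>C. \<forall>x. norm (Y x) \<le> C * norm x"
proof -
  show add: "Y (x + y) = Y x + Y y" for x y
    using assms by (simp add: bounded_op_def)
  show scale: "Y (scaleC a x) = scaleC a (Y x)" for a x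
    using assms by (simp add: bounded_op_def)
  show "Y 0 = 0"
    using scale[of 0 0] by simp
  show "Y (x - y) = Y x - Y y"
    using add[of "x - y" y] by simp
  show "\<exists>C. \<forall>x. norm (Y x) \<le> C * norm x"
    using assms by (simp add: bounded_op_def)
qed

text \<open>Tychonoff: the functions \<open>f n\<close> lie in a product of closed discs, which is
  compact. The index type is arbitrary, so convergence is along a filter finer than
  \<open>sequentially\<close> rather than along a subsequence.\<close>

lemma pointwise_cluster_point:
  fixes f :: "nat \<Rightarrow> 'i \<Rightarrow> complex"
  assumes "\<And>n i. cmod (f n i) \<le> K i"
  obtains F g where "F \<noteq> bot" "F \<le> sequentially" "\<And>i. ((\<lambda>n. f n i) \<longlongrightarrow> g i) F"
proof -
  define S where "S = PiE UNIV (\<lambda>i. cball (0::complex) (K i))"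
  have "compactin (product_topology (\<lambda>_. euclidean) UNIV) S"
    unfolding S_def compactin_PiE by simp
  then have "compact S"
    by (simp add: euclidean_product_topology)
  moreover have "eventually (\<lambda>x. x \<in> S) (filtermap f sequentially)"
    using assms by (simp add: eventually_filtermap S_def PiE_UNIV_domain)
  moreover have "filtermap f sequentially \<noteq> bot"
    by (simp add: filtermap_bot_iff)
  ultimately obtain g where g: "inf (nhds g) (filtermap f sequentially) \<noteq> bot"
    unfolding compact_filter by blast
  \<comment> \<open>Pulling neighbourhoods of \<open>g\<close> back along \<open>f\<close> forces
    convergence to \<open>g\<close>; this filter is proper because \<open>g\<close> is a cluster
    point.\<close>
  define F where "F = inf (filtercomap f (nhds g)) sequentially"
  have "F \<noteq> bot"
  proof
    assume "F = bot"
    then obtain P Q where P: "eventually P (nhds g)" and Q: "eventually Q sequentially"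
      and PQ: "\<And>n. P (f n) \<Longrightarrow> Q n \<Longrightarrow> False"
      unfolding F_def trivial_limit_def eventually_inf eventually_filtercomap by blast
    have "eventually (\<lambda>x. \<not> P x) (filtermap f sequentially)"
      unfolding eventually_filtermap by (rule eventually_mono[OF Q]) (use PQ in blast)
    then have "inf (nhds g) (filtermap f sequentially) = bot"
      using P unfolding trivial_limit_def eventually_inf by blast
    then show False
      using g by simp
  qed
  moreover have "F \<le> sequentially"
    by (simp add: F_def)
  moreover have "((\<lambda>n. f n i) \<longlongrightarrow> g i) F" for i
  proof -
    have fg: "(f \<longlongrightarrow> g) F"
      by (simp add: F_def filterlim_def filtermap_le_iff_le_filtercomap)
    show ?thesis
    proof (rule topological_tendstoI)
      fix U
      assume U: "open U" "g i \<in> U"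
      have "open ((\<lambda>h. h i) -` U)"
        by (rule open_vimage[OF U(1) continuous_on_product_coordinates])
      from topological_tendstoD[OF fg this] show "\<forall>\<^sub>F n in F. f n i \<in> U"
        using U(2) by simp
    qed
  qed
  ultimately show ?thesis
    by (rule that)
qed

text \<open>Compactness is applied to the matrix coefficients, indexed by pairs of vectors. Their
  limit is a bounded sesquilinear form, and Riesz turns it into an operator.\<close>

lemma weak_operator_cluster_point:
  fixes M :: "nat \<Rightarrow> 'a::complex_inner \<Rightarrow> 'b::chilbert"
  assumes M: "\<And>n. bounded_op UNIV UNIV (M n)" and M_le: "\<And>n x. norm (M n x) \<le> c * norm x"
  obtains F Y where "F \<noteq> bot" "F \<le> sequentially" "bounded_op UNIV UNIV Y"
    "\<And>x. norm (Y x) \<le> c * norm x" "\<And>x y. ((\<lambda>n. cinner y (M n x)) \<longlongrightarrow> cinner y (Y x)) F"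
proof -
  have bnd: "cmod (cinner y (M n x)) \<le> norm y * (c * norm x)" for n x y
    by (rule order_trans[OF cmod_cinner_le]) (intro mult_left_mono M_le norm_ge_zero)
  obtain F g where F: "F \<noteq> bot" "F \<le> sequentially"
    and g: "\<And>p. ((\<lambda>n. cinner (snd p) (M n (fst p))) \<longlongrightarrow> g p) F"
    by (rule pointwise_cluster_point[of "\<lambda>n p. cinner (snd p) (M n (fst p))"
          "\<lambda>p. norm (snd p) * (c * norm (fst p))"]) (use bnd in auto)
  have g: "((\<lambda>n. cinner y (M n x)) \<longlongrightarrow> g (x, y)) F" for x y
    using g[of "(x, y)"] by simp
  have g_le: "cmod (g (x, y)) \<le> norm y * (c * norm x)" for x y
    by (rule Lim_norm_ubound[OF F(1) g]) (simp add: bnd)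
  \<comment> \<open>\<open>cinner\<close> is conjugate-linear in its first argument, so
    \<open>g (x, y)\<close> must be conjugated to become linear in \<open>y\<close>.\<close>
  have "\<exists>z. \<forall>y. cnj (g (x, y)) = cinner z y" for x
  proof (rule riesz_representation)
    fix y y' a
    have "((\<lambda>n. cinner (y + y') (M n x)) \<longlongrightarrow> g (x, y) + g (x, y')) F"
      unfolding cinner_add_left by (intro tendsto_add g)
    then have "g (x, y + y') = g (x, y) + g (x, y')"
      using tendsto_unique[OF F(1) g] by blast
    then show "cnj (g (x, y + y')) = cnj (g (x, y)) + cnj (g (x, y'))"
      by simp
    have "((\<lambda>n. cinner (scaleC a y) (M n x)) \<longlongrightarrow> cnj a * g (x, y)) F"
      unfolding cinner_scaleC_left by (intro tendsto_mult tendsto_const g)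
    then have "g (x, scaleC a y) = cnj a * g (x, y)"
      using tendsto_unique[OF F(1) g] by blast
    then show "cnj (g (x, scaleC a y)) = a * cnj (g (x, y))"
      by simp
    show "cmod (cnj (g (x, y))) \<le> (c * norm x) * norm y"
      using g_le[of x y] by (simp add: mult.commute)
  qed
  then obtain Y where "\<And>x y. cnj (g (x, y)) = cinner (Y x) y"
    by metis
  then have Y: "g (x, y) = cinner y (Y x)" for x y
    by (metis cinner_commute complex_cnj_cnj)
  have lim: "((\<lambda>n. cinner y (M n x)) \<longlongrightarrow> cinner y (Y x)) F" for x y
    using g[of y x] by (simp add: Y)
  have le: "norm (Y x) \<le> c * norm x" for x
  proof (cases "Y x = 0")
    case True
    then show ?thesis
      \<comment> \<open>The bound on \<open>M\<close> itself shows that \<open>c * norm x\<close> is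
        nonnegative.\<close>
      using order_trans[OF norm_ge_zero M_le[of 0 x]] by simp
  next
    case False
    have "(norm (Y x))\<^sup>2 \<le> norm (Y x) * (c * norm x)"
      using g_le[of x "Y x"] by (simp add: Y cinner_self_norm norm_power)
    then show ?thesis
      using False by (simp add: power2_eq_square)
  qed
  have "bounded_op UNIV UNIV Y"
  proof (rule bounded_op_UNIV_intro[OF _ _ le])
    fix x x' a
    show "Y (x + x') = Y x + Y x'"
    proof (rule cinner_eqI)
      fix y
      have "((\<lambda>n. cinner y (M n (x + x'))) \<longlongrightarrow> cinner y (Y x) + cinner y (Y x')) F"
        unfolding bounded_op_UNIV_D(1)[OF M] cinner_add_right by (intro tendsto_add lim)
      then show "cinner y (Y (x + x')) = cinner y (Y x + Y x')"
        using tendsto_unique[OF F(1) lim] unfolding cinner_add_right by blast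
    qed
    show "Y (scaleC a x) = scaleC a (Y x)"
    proof (rule cinner_eqI)
      fix y
      have "((\<lambda>n. cinner y (M n (scaleC a x))) \<longlongrightarrow> a * cinner y (Y x)) F"
        unfolding bounded_op_UNIV_D(2)[OF M] cinner_scaleC_right
        by (intro tendsto_mult tendsto_const lim)
      then show "cinner y (Y (scaleC a x)) = cinner y (scaleC a (Y x))"
        using tendsto_unique[OF F(1) lim] unfolding cinner_scaleC_right by blast
    qed
  qed
  then show ?thesis
    using that F le lim by blast
qed

text \<open>The vector \<open>z\<close> is the adjoint of \<open>W\<close> applied to
  \<open>y\<close>. It lets \<open>W\<close> be moved off the operators whose weak limit is
  taken.\<close>

lemma adjoint_vector_exists:
  fixes W :: "'a::chilbert \<Rightarrow> 'b::complex_inner"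
  assumes "bounded_op UNIV UNIV W"
  shows "\<exists>z. \<forall>w. cinner y (W w) = cinner z w"
proof -
  obtain C where C: "\<And>w. norm (W w) \<le> C * norm w"
    using bounded_op_UNIV_D(5)[OF assms] by blast
  show ?thesis
  proof (rule riesz_representation)
    fix w
    show "cmod (cinner y (W w)) \<le> (norm y * C) * norm w"
      using order_trans[OF cmod_cinner_le mult_left_mono[OF C norm_ge_zero]]
      by (simp add: mult.assoc)
  qed (simp_all add: bounded_op_UNIV_D[OF assms] cinner_add_right cinner_scaleC_right)
qed

section \<open>Liftings\<close>

lemma bounded_op_UNIV_bounded_linear:
  assumes "bounded_op UNIV UNIV Y"
  shows "bounded_linear Y"
proof -
  obtain C where "\<And>x. norm (Y x) \<le> C * norm x"
    using bounded_op_UNIV_D(5)[OF assms] by blast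
  then show ?thesis
    by (intro bounded_linear_intro[where K = C])
      (simp_all add: bounded_op_UNIV_D(1,2)[OF assms] scaleC_of_real[symmetric] mult.commute)
qed

lemma
  assumes "bounded_op H K T" "csubspace H"
  shows op_norm_nonneg: "0 \<le> op_norm H T"
    and op_norm_bound: "x \<in> H \<Longrightarrow> norm (T x) \<le> op_norm H T * norm x"
proof -
  obtain C where C: "\<And>x. x \<in> H \<Longrightarrow> norm (T x) \<le> C * norm x"
    using assms(1) unfolding bounded_op_def by blast
  \<comment> \<open>The absolute value is taken because the constant supplied by
    \<open>bounded_op\<close> may be negative.\<close>
  have "norm (T x) \<le> \<bar>C\<bar>" if "x \<in> H" "norm x \<le> 1" for x
    using C[OF that(1)] mult_mono[of C "\<bar>C\<bar>" "norm x" 1] that(2) abs_ge_self[of C] by simp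
  then have bdd: "bdd_above ({0} \<union> {norm (T x) | x. x \<in> H \<and> norm x \<le> 1})"
    by (intro bdd_aboveI[of _ "\<bar>C\<bar>"]) auto
  show "0 \<le> op_norm H T"
    unfolding op_norm_def by (rule cSup_upper[OF _ bdd]) simp
  show "norm (T x) \<le> op_norm H T * norm x" if x: "x \<in> H"
  proof (cases "x = 0")
    case True
    then show ?thesis
      using C[OF x] by simp
  next
    case False
    define u where "u = scaleC (complex_of_real (inverse (norm x))) x"
    have "u \<in> H"
      using assms(2) x by (simp add: u_def csubspace_def)
    moreover have "norm u = 1"
      using False by (simp add: u_def norm_scaleC norm_inverse)
    ultimately have "norm (T u) \<le> op_norm H T"
      unfolding op_norm_def by (intro cSup_upper[OF _ bdd]) auto
    moreover have "norm (T u) = inverse (norm x) * norm (T x)"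
      using assms(1) x by (simp add: u_def bounded_op_def norm_scaleC norm_inverse)
    ultimately show ?thesis
      using False by (simp add: field_simps)
  qed
qed

lemma op_norm_le:
  assumes "\<And>x. x \<in> H \<Longrightarrow> norm (T x) \<le> c * norm x" "0 \<le> c"
  shows "op_norm H T \<le> c"
  unfolding op_norm_def
proof (rule cSup_least)
  fix y
  assume "y \<in> {0} \<union> {norm (T x) | x. x \<in> H \<and> norm x \<le> 1}"
  then consider "y = 0" | x where "y = norm (T x)" "x \<in> H" "norm x \<le> 1"
    by blast
  then show "y \<le> c"
  proof cases
    case 2
    then show ?thesis
      using assms(1)[of x] mult_left_mono[of "norm x" 1 c] assms(2) by simp
  qed (use assms(2) in simp)
qed simp

lemma csubspace_UNIV: "csubspace UNIV"
  by (simp add: csubspace_def)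

lemma orth_proj_of_orth_compl:
  fixes H :: "'a::chilbert set"
  assumes "closed_csubspace H" "x \<in> orth_compl H"
  shows "orth_proj H x = 0"
  using assms by (intro orth_proj_eqI) (simp_all add: closed_csubspace_def csubspace_def)

lemma orth_proj_of_in:
  fixes H :: "'a::chilbert set"
  assumes "closed_csubspace H" "x \<in> H"
  shows "orth_proj H x = x"
  using assms csubspace_orth_compl[of H] by (intro orth_proj_eqI) (simp_all add: csubspace_def)

text \<open>Split \<open>z\<close> into its parts in \<open>H1\<close> and in the complement; the
  second part is sent into the complement of \<open>H2\<close> and projects to zero. As an identity
  on the whole space it composes and iterates.\<close>

lemma lifting_orth_proj:
  fixes H1 :: "'a::chilbert set" and H2 :: "'b::chilbert set"
  assumes "closed_csubspace H1" "closed_csubspace H2" "is_lifting H1 H2 T S"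
  shows "orth_proj H2 (S z) = T (orth_proj H1 z)"
proof -
  have S: "bounded_op UNIV UNIV S"
    using assms(3) by (simp add: is_lifting_def)
  let ?p = "orth_proj H1 z"
  have "S z = S ?p + S (z - ?p)"
    by (simp add: bounded_op_UNIV_D(1)[OF S, symmetric])
  moreover have "S (z - ?p) \<in> orth_compl H2"
    using assms(3) orth_proj_residual[OF assms(1)] by (auto simp: is_lifting_def)
  ultimately have "orth_proj H2 (S z) = orth_proj H2 (S ?p)"
    using orth_proj_add[OF assms(2)] orth_proj_of_orth_compl[OF assms(2)] by simp
  also have "\<dots> = T ?p"
    using assms(3) orth_proj_in[OF assms(1)] by (simp add: is_lifting_def)
  finally show ?thesis .
qed

lemma lifting_funpow_orth_proj:
  fixes H :: "'a::chilbert set"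
  assumes "closed_csubspace H" "is_lifting H H T S"
  shows "orth_proj H ((S ^^ n) z) = (T ^^ n) (orth_proj H z)"
  by (induction n) (simp_all add: lifting_orth_proj[OF assms(1,1,2)])

lemma lifting_compose:
  fixes H1 :: "'a::chilbert set" and H2 :: "'b::chilbert set" and H3 :: "'c::chilbert set"
  assumes H: "closed_csubspace H1" "closed_csubspace H2" "closed_csubspace H3"
    and S: "is_lifting H1 H2 T S" and S': "is_lifting H2 H3 T' S'"
  shows "is_lifting H1 H3 (\<lambda>x. T' (T x)) (\<lambda>x. S' (S x))"
proof -
  have b: "bounded_op UNIV UNIV S" "bounded_op UNIV UNIV S'"
    using S S' by (simp_all add: is_lifting_def)
  have "bounded_linear (\<lambda>x. S' (S x))"
    by (intro bounded_linear_compose[of S' S] bounded_op_UNIV_bounded_linear b)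
  then obtain C where "\<And>x. norm (S' (S x)) \<le> norm x * C"
    using bounded_linear.bounded by blast
  then have "bounded_op UNIV UNIV (\<lambda>x. S' (S x))"
    by (intro bounded_op_UNIV_intro[where c = C])
      (simp_all add: bounded_op_UNIV_D[OF b(1)] bounded_op_UNIV_D[OF b(2)] mult.commute)
  moreover have "T' (T x) = orth_proj H3 (S' (S x))" if "x \<in> H1" for x
    using that by (simp add: lifting_orth_proj[OF H(2,3) S'] lifting_orth_proj[OF H(1,2) S]
        orth_proj_of_in[OF H(1)])
  ultimately show ?thesis
    using S S' unfolding is_lifting_def by blast
qed

lemma reducing_lifting:
  fixes H :: "'a::chilbert set"
  assumes H: "closed_csubspace H" and A: "bounded_op UNIV UNIV A" "reduces H A" "\<And>x. x \<in> H \<Longrightarrow> A x = B x"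
  shows "is_lifting H H B A"
proof -
  have "B x = orth_proj H (A x)" if "x \<in> H" for x
    using A(2,3) that orth_proj_of_in[OF H] by (metis image_subset_iff reduces_def)
  then show ?thesis
    using A by (simp add: is_lifting_def reduces_def)
qed

section \<open>Commutant lifting for an isometric and a contractive lifting\<close>

lemma commutant_lifting:
  fixes H1 :: "'a::chilbert set" and H2 :: "'b::chilbert set"
  assumes H1: "closed_csubspace H1" and H2: "closed_csubspace H2" and X: "bounded_op H1 H2 X"
    and V: "isometry_on UNIV V" "is_lifting H1 H1 T V"
    and W: "contraction_on UNIV W" "is_lifting H2 H2 T' W"
    and XT: "\<And>x. x \<in> H1 \<Longrightarrow> X (T x) = T' (X x)"
  obtains Y where "is_lifting H1 H2 X Y" "\<And>x. Y (V x) = W (Y x)" "op_norm UNIV Y = op_norm H1 X"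
proof -
  define c where "c = op_norm H1 X"
  \<comment> \<open>The trivial lifting, zero on the complement of \<open>H1\<close>. Every lifting
    of \<open>X\<close> has \<open>G\<close> as its component in \<open>H2\<close>, so
    \<open>adm\<close> below can express lifting by the condition on
    \<open>Y x - G x\<close>.\<close>
  define G where "G x = X (orth_proj H1 x)" for x
  have sub1: "csubspace H1"
    using H1 by (simp add: closed_csubspace_def)
  have c: "0 \<le> c"
    unfolding c_def by (rule op_norm_nonneg[OF X sub1])
  note P1 = orth_proj_in[OF H1]
  have G_in: "G x \<in> H2" for x
    using X P1 by (simp add: G_def bounded_op_def)
  have G_add: "G (x + y) = G x + G y" for x y
    using X P1 by (simp add: G_def orth_proj_add[OF H1] bounded_op_def)
  have G_scale: "G (scaleC a x) = scaleC a (G x)" for a x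
    using X P1 by (simp add: G_def orth_proj_scaleC[OF H1] bounded_op_def)
  have G_le: "norm (G x) \<le> c * norm x" for x
  proof -
    have "norm (G x) \<le> c * norm (orth_proj H1 x)"
      unfolding G_def c_def by (rule op_norm_bound[OF X sub1 P1])
    also have "\<dots> \<le> c * norm x"
      by (intro mult_left_mono norm_orth_proj_le H1 c)
    finally show ?thesis .
  qed
  have Vb: "bounded_op UNIV UNIV V" and V_norm: "norm (V x) = norm x" for x
    using V(1) by (simp_all add: isometry_on_def)
  have Wb: "bounded_op UNIV UNIV W" and W_norm: "norm (W x) \<le> norm x" for x
    using W(1) by (simp_all add: contraction_on_def)
  have "inj V"
  proof (rule injI)
    fix x y
    assume "V x = V y"
    then show "x = y"
      using V_norm[of "x - y"] by (simp add: bounded_op_UNIV_D(4)[OF Vb])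
  qed
  define adm where "adm Y \<longleftrightarrow> bounded_op UNIV UNIV Y \<and> (\<forall>x. norm (Y x) \<le> c * norm x) \<and>
    (\<forall>x. Y x - G x \<in> orth_compl H2)" for Y
  have "adm G"
    unfolding adm_def using bounded_op_UNIV_intro[OF G_add G_scale G_le] G_le
      csubspace_orth_compl[of H2] by (simp add: csubspace_def)
  have "\<exists>Y'. adm Y' \<and> (\<forall>x. Y' (V x) = W (Y x))" if Y: "adm Y" for Y
  proof -
    have Yb: "bounded_op UNIV UNIV Y" and Y_le: "norm (Y x) \<le> c * norm x"
      and Y_orth: "Y x - G x \<in> orth_compl H2" for x
      using Y by (auto simp: adm_def)
    \<comment> \<open>Well defined on the range of \<open>V\<close> because \<open>V\<close> is
      injective; since \<open>V\<close> preserves norms, \<open>S\<close> inherits the bound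
      \<open>c\<close>.\<close>
    define S where "S r = W (Y (inv V r))" for r
    have SV: "S (V x) = W (Y x)" for x
      using \<open>inj V\<close> by (simp add: S_def)
    note lin = bounded_op_UNIV_D(1,2)[OF Vb] bounded_op_UNIV_D(1,2)[OF Wb] bounded_op_UNIV_D(1,2)[OF Yb]
    have R: "csubspace (range V)"
      unfolding csubspace_def using bounded_op_UNIV_D[OF Vb] by (auto simp: image_iff) metis+
    have S_add: "S (x + y) = S x + S y" if "x \<in> range V" "y \<in> range V" for x y
      using that by (auto simp: lin(1)[symmetric] SV) (simp add: lin)
    have S_scale: "S (scaleC a x) = scaleC a (S x)" if "x \<in> range V" for a x
      using that by (auto simp: lin(2)[symmetric] SV) (simp add: lin)
    have S_le: "norm (S x) \<le> c * norm x" if "x \<in> range V" for x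
      using that order_trans[OF W_norm Y_le] by (auto simp: SV V_norm)
    have SG: "S x - G x \<in> orth_compl H2" if x: "x \<in> range V" for x
    proof -
      obtain z where z: "x = V z"
        using x by blast
      \<comment> \<open>Here the intertwining of \<open>X\<close> enters: it makes the
        \<open>H2\<close> component of \<open>W (Y z)\<close> equal to \<open>G (V z)\<close>, as
        Parrott's lemma requires.\<close>
      have "orth_proj H2 (W (Y z)) = T' (orth_proj H2 (Y z))"
        by (rule lifting_orth_proj[OF H2 H2 W(2)])
      also have "orth_proj H2 (Y z) = G z"
        by (rule orth_proj_eqI[OF H2 G_in Y_orth])
      also have "T' (G z) = G (V z)"
        using XT[OF P1, of z] by (simp add: G_def lifting_orth_proj[OF H1 H1 V(2)])
      finally show ?thesis
        using orth_proj_residual[OF H2, of "W (Y z)"] by (simp add: z SV)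
    qed
    obtain Y' where Y': "\<And>x y. Y' (x + y) = Y' x + Y' y" "\<And>a x. Y' (scaleC a x) = scaleC a (Y' x)"
      "\<And>x. norm (Y' x) \<le> c * norm x" "\<And>x. x \<in> range V \<Longrightarrow> Y' x = S x"
      "\<And>x. Y' x - G x \<in> orth_compl H2"
      by (rule parrott_extension[OF R S_add S_scale S_le G_in G_add G_scale G_le SG c]) blast+
    have "adm Y'"
      unfolding adm_def using bounded_op_UNIV_intro[OF Y'(1,2,3)] Y' by blast
    moreover have "Y' (V x) = W (Y x)" for x
      using Y'(4)[of "V x"] by (simp add: SV)
    ultimately show ?thesis
      by blast
  qed
  then obtain \<Phi> where \<Phi>: "\<And>Y. adm Y \<Longrightarrow> adm (\<Phi> Y)" "\<And>Y x. adm Y \<Longrightarrow> \<Phi> Y (V x) = W (Y x)"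
    by metis
  define A where "A n = (\<Phi> ^^ n) G" for n
  have A_adm: "adm (A n)" for n
    by (induction n) (simp_all add: A_def \<open>adm G\<close> \<Phi>)
  have A_Suc: "A (Suc n) (V x) = W (A n x)" for n x
    using \<Phi>(2)[OF A_adm] by (simp add: A_def)
  have Ab: "bounded_op UNIV UNIV (A n)" and A_le: "norm (A n x) \<le> c * norm x"
    and A_orth: "A n x - G x \<in> orth_compl H2" for n x
    using A_adm by (auto simp: adm_def)
  \<comment> \<open>Averaging over \<open>Suc n\<close> iterates avoids division by zero at
    \<open>n = 0\<close>.\<close>
  define M where "M n x = (1 / real (Suc n)) *\<^sub>R (\<Sum>k<Suc n. A k x)" for n x
  have M_le: "norm (M n x) \<le> c * norm x" for n x
  proof -
    have "norm (\<Sum>k<Suc n. A k x) \<le> (\<Sum>k<Suc n. c * norm x)"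
      by (intro sum_norm_le A_le)
    then have "norm (\<Sum>k<Suc n. A k x) \<le> real (Suc n) * (c * norm x)"
      by (simp only: sum_constant card_lessThan)
    then show ?thesis
      unfolding M_def norm_scaleR by (simp add: pos_divide_le_eq mult.commute del: sum.lessThan_Suc)
  qed
  have "bounded_op UNIV UNIV (M n)" for n
  proof (rule bounded_op_UNIV_intro[OF _ _ M_le])
    fix x y a
    show "M n (x + y) = M n x + M n y"
      unfolding M_def bounded_op_UNIV_D(1)[OF Ab] sum.distrib scaleR_add_right ..
    have "(\<Sum>k<Suc n. scaleC a (A k x)) = scaleC a (\<Sum>k<Suc n. A k x)"
      by (rule linear_sum[OF bounded_linear.linear[OF bounded_linear_scaleC], symmetric])
    then show "M n (scaleC a x) = scaleC a (M n x)"
      unfolding M_def bounded_op_UNIV_D(2)[OF Ab]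
      by (simp add: linear_scale[OF bounded_linear.linear[OF bounded_linear_scaleC]])
  qed
  then obtain F Y where F: "F \<noteq> bot" "F \<le> sequentially" and Yb: "bounded_op UNIV UNIV Y"
    and Y_le: "\<And>x. norm (Y x) \<le> c * norm x"
    and Y_lim: "\<And>x y. ((\<lambda>n. cinner y (M n x)) \<longlongrightarrow> cinner y (Y x)) F"
    using weak_operator_cluster_point[of M c] M_le by blast
  have Y_orth: "Y x - G x \<in> orth_compl H2" for x
  proof -
    have "cinner h (Y x - G x) = 0" if h: "h \<in> H2" for h
    proof -
      \<comment> \<open>All iterates have the same \<open>H2\<close> component, hence so do their
        averages and any weak limit.\<close>
      have "cinner h (A k x) = cinner h (G x)" for k
        using A_orth[of k x] h by (simp add: orth_compl_def cinner_diff_right)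
      then have "cinner h (M n x) = cinner h (G x)" for n
        unfolding M_def using of_nat_neq_0[of n, where ?'a = complex]
        by (simp add: linear_scale[OF bounded_linear.linear[OF bounded_linear_cinner_right]]
            linear_sum[OF bounded_linear.linear[OF bounded_linear_cinner_right]] scaleR_conv_of_real
            field_simps del: sum.lessThan_Suc)
      then have "cinner h (Y x) = cinner h (G x)"
        using tendsto_unique[OF F(1) Y_lim[of h x]] by simp
      then show ?thesis
        by (simp add: cinner_diff_right)
    qed
    then show ?thesis
      by (simp add: orth_compl_def)
  qed
  have Y_V: "Y (V x) = W (Y x)" for x
  proof (rule cinner_eqI)
    fix y
    obtain z where z: "\<And>w. cinner y (W w) = cinner z w"
      using adjoint_vector_exists[OF Wb] by blast
    \<comment> \<open>Applying \<open>W\<close> shifts the iterates by one, so the difference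
      telescopes to its end terms. These stay bounded while the factor tends to zero.\<close>
    have diff: "M n (V x) - W (M n x) = (1 / real (Suc n)) *\<^sub>R (A 0 (V x) - A (Suc n) (V x))" for n
    proof -
      have "W (M n x) = (1 / real (Suc n)) *\<^sub>R (\<Sum>k<Suc n. A (Suc k) (V x))"
        unfolding M_def A_Suc
        by (simp add: linear_scale[OF bounded_linear.linear[OF bounded_op_UNIV_bounded_linear[OF Wb]]]
            linear_sum[OF bounded_linear.linear[OF bounded_op_UNIV_bounded_linear[OF Wb]]]
            del: sum.lessThan_Suc)
      then show ?thesis
        unfolding M_def
        using sum_lessThan_telescope'[of "\<lambda>k. A k (V x)" "Suc n"]
        by (simp add: scaleR_diff_right[symmetric] sum_subtractf[symmetric] del: sum.lessThan_Suc)
    qed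
    have "(\<lambda>n. M n (V x) - W (M n x)) \<longlonglongrightarrow> 0"
    proof (rule Lim_null_comparison)
      have "norm (A 0 (V x) - A (Suc n) (V x)) \<le> 2 * c * norm x" for n
        using norm_triangle_ineq4[of "A 0 (V x)" "A (Suc n) (V x)"] A_le[of 0 "V x"] A_le[of "Suc n" "V x"]
        by (simp add: V_norm)
      then show "\<forall>\<^sub>F n in sequentially.
          norm (M n (V x) - W (M n x)) \<le> inverse (real (Suc n)) * (2 * c * norm x)"
        unfolding diff by (intro always_eventually allI) (simp add: divide_simps)
      show "(\<lambda>n. inverse (real (Suc n)) * (2 * c * norm x)) \<longlonglongrightarrow> 0"
        by (rule tendsto_mult_left_zero[OF LIMSEQ_inverse_real_of_nat])
    qed
    then have "((\<lambda>n. cinner y (M n (V x) - W (M n x))) \<longlongrightarrow> cinner y 0) F"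
      using F(2) tendsto_mono by (intro tendsto_cinner_right) blast
    \<comment> \<open>Weak convergence at \<open>V x\<close> against \<open>y\<close>, and at
      \<open>x\<close> against the adjoint vector \<open>z\<close>.\<close>
    moreover have "((\<lambda>n. cinner y (M n (V x) - W (M n x))) \<longlongrightarrow> cinner y (Y (V x)) - cinner y (W (Y x))) F"
      unfolding cinner_diff_right z by (intro tendsto_diff Y_lim)
    ultimately have "cinner y (Y (V x)) - cinner y (W (Y x)) = cinner y 0"
      using tendsto_unique[OF F(1)] by blast
    then show "cinner y (Y (V x)) = cinner y (W (Y x))"
      by simp
  qed
  have lift: "is_lifting H1 H2 X Y"
    unfolding is_lifting_def
  proof (intro conjI ballI Yb)
    have "Y x \<in> orth_compl H2" if "x \<in> orth_compl H1" for x
      using Y_orth[of x] G_scale[of 0 0] orth_proj_of_orth_compl[OF H1 that]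
        orth_proj_of_orth_compl[OF H1, of 0] csubspace_orth_compl[of H1]
      by (simp add: G_def csubspace_def)
    then show "Y ` orth_compl H1 \<subseteq> orth_compl H2"
      by blast
    fix x
    assume "x \<in> H1"
    then have "G x = X x"
      by (simp add: G_def orth_proj_of_in[OF H1])
    then show "X x = orth_proj H2 (Y x)"
      using orth_proj_eqI[OF H2 G_in Y_orth, of x] by simp
  qed
  have "op_norm UNIV Y \<le> c"
    by (rule op_norm_le[OF Y_le c])
  \<comment> \<open>No lifting has smaller norm than \<open>X\<close>, since \<open>X\<close> is
    recovered from it by a norm-decreasing projection.\<close>
  moreover have "c \<le> op_norm UNIV Y"
    unfolding c_def
  proof (rule op_norm_le[OF _ op_norm_nonneg[OF Yb csubspace_UNIV]])
    fix x
    assume "x \<in> H1"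
    then have "norm (X x) \<le> norm (Y x)"
      using lift norm_orth_proj_le[OF H2] by (simp add: is_lifting_def)
    then show "norm (X x) \<le> op_norm UNIV Y * norm x"
      using op_norm_bound[OF Yb csubspace_UNIV, of x] by simp
  qed
  ultimately show ?thesis
    using that[OF lift Y_V] by (simp add: c_def)
qed

section \<open>Reduction of the three cases to commutant lifting\<close>

theorem mainTheorem4:
  fixes H1 :: "'k1::chilbert set" and H2 :: "'k2::chilbert set"
    and T1 V1 :: "'k1 \<Rightarrow> 'k1" and T2 V2 :: "'k2 \<Rightarrow> 'k2"
    and X :: "'k1 \<Rightarrow> 'k2"
  assumes H1: "closed_csubspace H1" and H2: "closed_csubspace H2"
    and T1: "contraction_on H1 T1" and T2: "contraction_on H2 T2"
    and V1: "isometric_lifting H1 T1 V1" and V2: "isometric_lifting H2 T2 V2"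
    and X: "bounded_op H1 H2 X"
  shows
   "(\<forall>(Q :: 'k2 \<Rightarrow> 'k2) (Qb :: 'k2 \<Rightarrow> 'k2).
       contraction_on H2 Q \<and> contraction_on UNIV Qb \<and> reduces H2 Qb \<and> (\<forall>x\<in>H2. Qb x = Q x) \<longrightarrow>
       ((\<forall>x\<in>H1. X (T1 x) = Q (T2 (X x))) \<longrightarrow>
          (\<exists>Y. is_lifting H1 H2 X Y \<and> (\<forall>x. Y (V1 x) = Qb (V2 (Y x))) \<and>
               (\<forall>n. \<forall>x\<in>H1. (T2 ^^ n) (X x) = orth_proj H2 ((V2 ^^ n) (Y x))) \<and>
               (\<forall>n. \<forall>x\<in>H1. X ((T1 ^^ n) x) = orth_proj H2 (Y ((V1 ^^ n) x))) \<and>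
               op_norm UNIV Y = op_norm H1 X)) \<and>
       ((\<forall>x\<in>H1. X (T1 x) = T2 (Q (X x))) \<longrightarrow>
          (\<exists>Y. is_lifting H1 H2 X Y \<and> (\<forall>x. Y (V1 x) = V2 (Qb (Y x))) \<and>
               (\<forall>n. \<forall>x\<in>H1. (T2 ^^ n) (X x) = orth_proj H2 ((V2 ^^ n) (Y x))) \<and>
               (\<forall>n. \<forall>x\<in>H1. X ((T1 ^^ n) x) = orth_proj H2 (Y ((V1 ^^ n) x))) \<and>
               op_norm UNIV Y = op_norm H1 X))) \<and>
    (\<forall>(Q :: 'k1 \<Rightarrow> 'k1) (Qb :: 'k1 \<Rightarrow> 'k1).
       unitary_on H1 Q \<and> unitary_on UNIV Qb \<and> reduces H1 Qb \<and> (\<forall>x\<in>H1. Qb x = Q x) \<longrightarrow>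
       ((\<forall>x\<in>H1. X (T1 x) = T2 (X (Q x))) \<longrightarrow>
          (\<exists>Y. is_lifting H1 H2 X Y \<and> (\<forall>x. Y (V1 x) = V2 (Y (Qb x))) \<and>
               (\<forall>n. \<forall>x\<in>H1. (T2 ^^ n) (X x) = orth_proj H2 ((V2 ^^ n) (Y x))) \<and>
               (\<forall>n. \<forall>x\<in>H1. X ((T1 ^^ n) x) = orth_proj H2 (Y ((V1 ^^ n) x))) \<and>
               op_norm UNIV Y = op_norm H1 X)))"
proof -
  have lift1: "is_lifting H1 H1 T1 V1" and iso1: "isometry_on UNIV V1"
    and lift2: "is_lifting H2 H2 T2 V2" and iso2: "isometry_on UNIV V2"
    using V1 V2 by (simp_all add: isometric_lifting_def)
  \<comment> \<open>These formulas hold for every lifting of \<open>X\<close>: the projection passes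
    through \<open>V2 ^^ n\<close>, \<open>Y\<close> and \<open>V1 ^^ n\<close>, turning each into
    the operator it lifts.\<close>
  have powers: "(T2 ^^ n) (X x) = orth_proj H2 ((V2 ^^ n) (Y x))"
    "X ((T1 ^^ n) x) = orth_proj H2 (Y ((V1 ^^ n) x))"
    if "is_lifting H1 H2 X Y" "x \<in> H1" for Y n x
    using that(2) by (simp_all add: lifting_funpow_orth_proj[OF H2 lift2] lifting_funpow_orth_proj[OF H1 lift1]
        lifting_orth_proj[OF H1 H2 that(1)] orth_proj_of_in[OF H1])
  show ?thesis
  proof (intro conjI allI impI)
    fix Q Qb :: "'k2 \<Rightarrow> 'k2"
    assume Q: "contraction_on H2 Q \<and> contraction_on UNIV Qb \<and> reduces H2 Qb \<and> (\<forall>x\<in>H2. Qb x = Q x)"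
    then have liftQ: "is_lifting H2 H2 Q Qb"
      by (intro reducing_lifting[OF H2]) (auto simp: contraction_on_def)
    have Qb_le: "norm (Qb x) \<le> norm x" for x
      using Q by (simp add: contraction_on_def)
    have V2_norm: "norm (V2 x) = norm x" for x
      using iso2 by (simp add: isometry_on_def)
    {
      assume XT: "\<forall>x\<in>H1. X (T1 x) = Q (T2 (X x))"
      have W: "is_lifting H2 H2 (\<lambda>x. Q (T2 x)) (\<lambda>x. Qb (V2 x))"
        by (rule lifting_compose[OF H2 H2 H2 lift2 liftQ])
      moreover have "contraction_on UNIV (\<lambda>x. Qb (V2 x))"
        using W Qb_le[of "V2 _"] by (simp add: contraction_on_def is_lifting_def V2_norm)
      ultimately obtain Y where "is_lifting H1 H2 X Y" "\<And>x. Y (V1 x) = Qb (V2 (Y x))"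
        "op_norm UNIV Y = op_norm H1 X"
        using commutant_lifting[OF H1 H2 X iso1 lift1, of "\<lambda>x. Qb (V2 x)" "\<lambda>x. Q (T2 x)"] XT by blast
      then show "\<exists>Y. is_lifting H1 H2 X Y \<and> (\<forall>x. Y (V1 x) = Qb (V2 (Y x))) \<and>
               (\<forall>n. \<forall>x\<in>H1. (T2 ^^ n) (X x) = orth_proj H2 ((V2 ^^ n) (Y x))) \<and>
               (\<forall>n. \<forall>x\<in>H1. X ((T1 ^^ n) x) = orth_proj H2 (Y ((V1 ^^ n) x))) \<and>
               op_norm UNIV Y = op_norm H1 X"
        using powers by blast
    next
      assume XT: "\<forall>x\<in>H1. X (T1 x) = T2 (Q (X x))"
      have W: "is_lifting H2 H2 (\<lambda>x. T2 (Q x)) (\<lambda>x. V2 (Qb x))"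
        by (rule lifting_compose[OF H2 H2 H2 liftQ lift2])
      moreover have "contraction_on UNIV (\<lambda>x. V2 (Qb x))"
        using W Qb_le by (simp add: contraction_on_def is_lifting_def V2_norm)
      ultimately obtain Y where "is_lifting H1 H2 X Y" "\<And>x. Y (V1 x) = V2 (Qb (Y x))"
        "op_norm UNIV Y = op_norm H1 X"
        using commutant_lifting[OF H1 H2 X iso1 lift1, of "\<lambda>x. V2 (Qb x)" "\<lambda>x. T2 (Q x)"] XT by blast
      then show "\<exists>Y. is_lifting H1 H2 X Y \<and> (\<forall>x. Y (V1 x) = V2 (Qb (Y x))) \<and>
               (\<forall>n. \<forall>x\<in>H1. (T2 ^^ n) (X x) = orth_proj H2 ((V2 ^^ n) (Y x))) \<and>
               (\<forall>n. \<forall>x\<in>H1. X ((T1 ^^ n) x) = orth_proj H2 (Y ((V1 ^^ n) x))) \<and>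
               op_norm UNIV Y = op_norm H1 X"
        using powers by blast
    }
  next
    fix Q Qb :: "'k1 \<Rightarrow> 'k1"
    assume Q: "unitary_on H1 Q \<and> unitary_on UNIV Qb \<and> reduces H1 Qb \<and> (\<forall>x\<in>H1. Qb x = Q x)"
      and XT: "\<forall>x\<in>H1. X (T1 x) = T2 (X (Q x))"
    define U where "U = inv Qb"
    have Qb: "bounded_op UNIV UNIV Qb" and Qb_norm: "norm (Qb x) = norm x" and Qb_surj: "surj Qb" for x
      using Q by (simp_all add: unitary_on_def isometry_on_def)
    have QbU: "Qb (U x) = x" for x
      using Qb_surj by (simp add: U_def surj_f_inv_f)
    have "inj Qb"
    proof (rule injI)
      fix x y
      assume "Qb x = Qb y"
      then show "x = y"
        using Qb_norm[of "x - y"] by (simp add: bounded_op_UNIV_D(4)[OF Qb])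
    qed
    then have UQb: "U (Qb x) = x" for x
      by (simp add: U_def)
    have U_norm: "norm (U x) = norm x" for x
      using Qb_norm[of "U x"] by (simp add: QbU)
    have Ub: "bounded_op UNIV UNIV U"
    proof (rule bounded_op_UNIV_intro[where c = 1])
      fix x y a
      show "U (x + y) = U x + U y"
        using UQb[of "U x + U y"] by (simp add: bounded_op_UNIV_D(1)[OF Qb] QbU)
      show "U (scaleC a x) = scaleC a (U x)"
        using UQb[of "scaleC a (U x)"] by (simp add: bounded_op_UNIV_D(2)[OF Qb] QbU)
    qed (simp add: U_norm)
    \<comment> \<open>\<open>reduces\<close> gives only that \<open>Qb\<close> maps
      \<open>H1\<close> into itself; invariance under the inverse comes from surjectivity of
      \<open>Q\<close> on \<open>H1\<close>.\<close>
    have U_H1: "U x \<in> H1" if "x \<in> H1" for x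
    proof -
      have "x \<in> Q ` H1"
        using Q that by (simp add: unitary_on_def)
      then obtain h where "h \<in> H1" "x = Qb h"
        using Q by auto
      then show ?thesis
        by (simp add: UQb)
    qed
    \<comment> \<open>The \<open>H1\<close> component of \<open>U x\<close> is mapped by
      \<open>Qb\<close> into \<open>H1\<close> and, as a difference of two vectors in the
      complement, also into the complement. So its image is zero, and \<open>Qb\<close> preserves
      norms.\<close>
    have "U x \<in> orth_compl H1" if x: "x \<in> orth_compl H1" for x
    proof -
      let ?p = "orth_proj H1 (U x)"
      have "Qb ?p = x - Qb (U x - ?p)"
        by (simp add: bounded_op_UNIV_D(4)[OF Qb] QbU)
      moreover have "Qb (U x - ?p) \<in> orth_compl H1"
        using Q orth_proj_residual[OF H1] by (auto simp: reduces_def)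
      ultimately have "Qb ?p \<in> orth_compl H1"
        using csubspace_diff[OF csubspace_orth_compl x] by simp
      moreover have "Qb ?p \<in> H1"
        using Q orth_proj_in[OF H1] by (auto simp: reduces_def)
      ultimately have "Qb ?p = 0"
        using in_csubspace_and_orth_compl by blast
      then have "?p = 0"
        using Qb_norm[of ?p] by simp
      then show ?thesis
        using orth_proj_residual[OF H1, of "U x"] by simp
    qed
    then have "is_lifting H1 H1 U U"
      using U_H1 by (intro reducing_lifting[OF H1 Ub]) (auto simp: reduces_def)
    then have lift: "is_lifting H1 H1 (\<lambda>x. T1 (U x)) (\<lambda>x. V1 (U x))"
      using lifting_compose[OF H1 H1 H1 _ lift1] by blast
    moreover have "isometry_on UNIV (\<lambda>x. V1 (U x))"
      using lift iso1 by (simp add: isometry_on_def is_lifting_def U_norm)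
    moreover have "contraction_on UNIV V2"
      using iso2 by (simp add: isometry_on_def contraction_on_def)
    \<comment> \<open>The hypothesis at \<open>U x\<close>, where \<open>Q (U x) = x\<close>, moves
      the unitary to the other side of the intertwining relation.\<close>
    moreover have "X (T1 (U x)) = T2 (X x)" if "x \<in> H1" for x
      using XT U_H1[OF that] Q QbU[of x] by metis
    ultimately obtain Y where Y: "is_lifting H1 H2 X Y" "\<And>x. Y (V1 (U x)) = V2 (Y x)"
      "op_norm UNIV Y = op_norm H1 X"
      using commutant_lifting[OF H1 H2 X, of "\<lambda>x. V1 (U x)" "\<lambda>x. T1 (U x)" V2 T2] lift2 by blast
    have "Y (V1 x) = V2 (Y (Qb x))" for x
      using Y(2)[of "Qb x"] by (simp add: UQb)
    then show "\<exists>Y. is_lifting H1 H2 X Y \<and> (\<forall>x. Y (V1 x) = V2 (Y (Qb x))) \<and>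
               (\<forall>n. \<forall>x\<in>H1. (T2 ^^ n) (X x) = orth_proj H2 ((V2 ^^ n) (Y x))) \<and>
               (\<forall>n. \<forall>x\<in>H1. X ((T1 ^^ n) x) = orth_proj H2 (Y ((V1 ^^ n) x))) \<and>
               op_norm UNIV Y = op_norm H1 X"
      using Y(1,3) powers by blast
  qed
qed

end
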